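(* Let $G$ and $K$ be groups, let $G$ act trivially on $K$, and let $d\colon G\to K$ be any derivation (that is, any group homomorphism). Then $$\mathrm{tc}(d)=\mathrm{TC}(Bd),$$ where $Bd\colon BG\to BK$ is the map of classifying spaces induced by $d$ and $\mathrm{TC}(Bd)$ is its topological complexity.
   Context: All groups are discrete; $G$ is written multiplicatively and $K$ additively (even though $K$ need not be abelian). If $G$ acts on $K$ by automorphisms, $(g,k)\mapsto g\cdot k$, the semi-direct product $K\rtimes G$ is the set $K\times G$ with $(k,g)(k',g')=(k+g\cdot k',gg')$, with projection $p(k,g)=g$. A derivation is a function $d\colon G\to K$ with $d(gh)=d(g)+g\cdot d(h)$; it determines the splitting $s_d(g)=(d(g),g)$ of $p$. A functorial classifying space construction gives a fibration $Bp\colon B(K\rtimes G)\to BG$ with fibre $BK$ and section $B(s_d)$. For a fibration $q\colon E\to Y$, the sectional category $\mathrm{secat}(q)$ is the minimal $n$ such that $Y$ has an open cover $U_0,\dots,U_n$ with each $U_i$ admitting a section $U_i\to E$ of $q$ ($\infty$ if there is no such $n$). For a fibration $q\colon X\to B$ with section $s\colon B\to X$, let $P_BX=\{\alpha\colon I\to X \text{ continuous}\mid q\circ\alpha \text{ constant},\ \alpha(0)=s(q(\alpha(0)))\}$ and $\mathrm{ev}_1\colon P_BX\to X$, $\alpha\mapsto\alpha(1)$. The complexity of $d$ is the $BG$-parametrized LS-category of $B(K\rtimes G)$ with respect to the section $B(s_d)$ of $Bp$, that is, $$\mathrm{tc}(d):=\mathrm{cat}_{BG}(B(K\rtimes G))=\mathrm{secat}\big(\mathrm{ev}_1\colon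 P_{BG}B(K\rtimes G)\to B(K\rtimes G)\big).$$ Topological complexity of a map: for a fibration $f\colon X\to Y$, $\mathrm{TC}(f)$ is the sectional category of the fibration $X^I\to X\times Y$, $\alpha\mapsto(\alpha(0),f(\alpha(1)))$. The map $Bd$ is only defined up to homotopy, and $\mathrm{TC}(Bd)$ is understood for a model of $Bd$ that is a fibration (a fibrational replacement). *)

theory Defs
  imports "HOL-Analysis.Analysis" "HOL-Algebra.Group_Action"
begin

section \<open>Path spaces, fibrations, sectional category\<close>

text \<open>The space \<open>X\<^sup>I\<close> with the compact-open topology. Paths are functions on the reals that are
  \<^const>\<open>undefined\<close> outside the unit interval, so that points of the space are paths.\<close>

definition path_space :: "'a topology \<Rightarrow> (real \<Rightarrow> 'a) topology" where
  "path_space X = topology_generated_by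
     {{\<alpha> \<in> extensional {0..1}. pathin X \<alpha> \<and> \<alpha> ` C \<subseteq> U} | C U.
        compact C \<and> C \<subseteq> {0..1} \<and> openin X U}"

definition homotopy_lifting ::
    "'z topology \<Rightarrow> 'e topology \<Rightarrow> 'b topology \<Rightarrow> ('e \<Rightarrow> 'b) \<Rightarrow> bool" where
  "homotopy_lifting Z E B q \<longleftrightarrow>
     (\<forall>f H. continuous_map Z E f \<and>
            continuous_map (prod_topology (top_of_set {0..1::real}) Z) B H \<and>
            (\<forall>z \<in> topspace Z. H (0, z) = q (f z)) \<longrightarrow>
        (\<exists>H'. continuous_map (prod_topology (top_of_set {0..1::real}) Z) E H' \<and>
              (\<forall>z \<in> topspace Z. H' (0, z) = f z) \<and>
              (\<forall>t \<in> {0..1}. \<forall>z \<in> topspace Z. q (H' (t, z)) = H (t, z))))"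

text \<open>Hurewicz fibrations. A definition cannot quantify over all types, so the test spaces \<open>Z\<close> range
  over one type, large enough to contain the universal test space
  \<open>{(e, \<gamma>) \<in> E \<times> B\<^sup>I. \<gamma> 0 = q e}\<close>; lemma \<open>fibration_homotopy_lifting\<close> below gives the lifting
  property for spaces of every type.\<close>

definition fibration :: "'e topology \<Rightarrow> 'b topology \<Rightarrow> ('e \<Rightarrow> 'b) \<Rightarrow> bool" where
  "fibration E B q \<longleftrightarrow>
     continuous_map E B q \<and> (\<forall>Z :: ('e \<times> (real \<Rightarrow> 'b)) topology. homotopy_lifting Z E B q)"

text \<open>The infimum of the empty set in \<^typ>\<open>enat\<close> is \<open>\<infinity>\<close>.\<close>

definition secat :: "'e topology \<Rightarrow> 'b topology \<Rightarrow> ('e \<Rightarrow> 'b) \<Rightarrow> enat" where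
  "secat E B q = Inf (enat ` {n. \<exists>U :: nat \<Rightarrow> 'b set.
     (\<Union>i\<le>n. U i) = topspace B \<and>
     (\<forall>i\<le>n. openin B (U i) \<and>
        (\<exists>s. continuous_map (subtopology B (U i)) E s \<and> (\<forall>b \<in> U i. q (s b) = b)))})"

text \<open>\<open>P\<^sub>B X\<close> for \<open>q : X \<rightarrow> B\<close> with section \<open>s\<close>, and the parametrized LS-category of \<open>X\<close>.\<close>

definition fibre_path_space ::
    "'x topology \<Rightarrow> ('x \<Rightarrow> 'b) \<Rightarrow> ('b \<Rightarrow> 'x) \<Rightarrow> (real \<Rightarrow> 'x) topology" where
  "fibre_path_space X q s = subtopology (path_space X)
     {\<alpha>. (\<exists>b. \<forall>t \<in> {0..1}. q (\<alpha> t) = b) \<and> \<alpha> 0 = s (q (\<alpha> 0))}"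

definition parametrized_cat :: "'x topology \<Rightarrow> ('x \<Rightarrow> 'b) \<Rightarrow> ('b \<Rightarrow> 'x) \<Rightarrow> enat" where
  "parametrized_cat X q s = secat (fibre_path_space X q s) X (\<lambda>\<alpha>. \<alpha> 1)"

text \<open>Topological complexity of a fibration \<open>f : X \<rightarrow> Y\<close>.\<close>

definition TC_map :: "'x topology \<Rightarrow> 'y topology \<Rightarrow> ('x \<Rightarrow> 'y) \<Rightarrow> enat" where
  "TC_map X Y f = secat (path_space X) (prod_topology X Y) (\<lambda>\<alpha>. (\<alpha> 0, f (\<alpha> 1)))"

definition homotopy_equivalence_map :: "'a topology \<Rightarrow> 'b topology \<Rightarrow> ('a \<Rightarrow> 'b) \<Rightarrow> bool" where
  "homotopy_equivalence_map X Y u \<longleftrightarrow> continuous_map X Y u \<and>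
     (\<exists>v. continuous_map Y X v \<and>
          homotopic_with (\<lambda>_. True) X X (v \<circ> u) id \<and>
          homotopic_with (\<lambda>_. True) Y Y (u \<circ> v) id)"

text \<open>\<open>f : X \<rightarrow> Y\<close> is a fibration that agrees with \<open>g : A \<rightarrow> B\<close> up to homotopy equivalences
  \<open>X \<simeq> A\<close> and \<open>Y \<simeq> B\<close>.\<close>

definition fibrational_replacement ::
    "'x topology \<Rightarrow> 'y topology \<Rightarrow> ('x \<Rightarrow> 'y) \<Rightarrow>
     'a topology \<Rightarrow> 'b topology \<Rightarrow> ('a \<Rightarrow> 'b) \<Rightarrow> bool" where
  "fibrational_replacement X Y f A B g \<longleftrightarrow> fibration X Y f \<and>
     (\<exists>u v. homotopy_equivalence_map X A u \<and> homotopy_equivalence_map Y B v \<and>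
            homotopic_with (\<lambda>_. True) X B (v \<circ> f) (g \<circ> u))"


section \<open>Semi-direct products and derivations\<close>

text \<open>An action of \<open>G\<close> on \<open>K\<close> by automorphisms is a homomorphism \<open>\<phi> \<in> hom G (AutoGroup K)\<close>;
  \<open>K\<close> is written multiplicatively.\<close>

definition semidirect_product ::
    "('k, 'c) monoid_scheme \<Rightarrow> ('g, 'd) monoid_scheme \<Rightarrow> ('g \<Rightarrow> 'k \<Rightarrow> 'k) \<Rightarrow> ('k \<times> 'g) monoid" where
  "semidirect_product K G \<phi> =
     \<lparr>carrier = carrier K \<times> carrier G,
      mult = (\<lambda>(k, g) (k', g'). (k \<otimes>\<^bsub>K\<^esub> \<phi> g k', g \<otimes>\<^bsub>G\<^esub> g')),
      one = (\<one>\<^bsub>K\<^esub>, \<one>\<^bsub>G\<^esub>)\<rparr>"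

definition derivation ::
    "('g, 'd) monoid_scheme \<Rightarrow> ('k, 'c) monoid_scheme \<Rightarrow> ('g \<Rightarrow> 'k \<Rightarrow> 'k) \<Rightarrow> ('g \<Rightarrow> 'k) \<Rightarrow> bool" where
  "derivation G K \<phi> d \<longleftrightarrow> d \<in> carrier G \<rightarrow> carrier K \<and>
     (\<forall>g \<in> carrier G. \<forall>h \<in> carrier G. d (g \<otimes>\<^bsub>G\<^esub> h) = d g \<otimes>\<^bsub>K\<^esub> \<phi> g (d h))"


section \<open>A functorial classifying space\<close>

text \<open>The geometric realization of the homogeneous bar construction of a discrete group \<open>G\<close> has as
  its points the right-continuous step functions \<open>[0,1) \<rightarrow> G\<close>: the point of the simplex
  \<open>(g\<^sub>0,\<dots>,g\<^sub>n)\<close> with barycentric coordinates \<open>x\<^sub>0,\<dots>,x\<^sub>n\<close> takes the value \<open>g\<^sub>i\<close> on the \<open>i\<close>th of the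
  consecutive intervals of lengths \<open>x\<^sub>0,\<dots>,x\<^sub>n\<close>. We give it the metric topology of convergence in
  measure (the Hartman-Mycielski model of \<open>EG\<close>) instead of the weak topology. This \<open>EG\<close> is
  contractible, \<open>G\<close> acts on it by isometries moving every point by distance 1, so that
  \<open>EG \<rightarrow> BG = EG/G\<close> is a principal covering of a metrizable space, and for a semi-direct product \<open>Bp\<close>
  is a fibration with fibre \<open>BK\<close> with respect to all topological spaces (for the weak topology one
  would have to work with compactly generated spaces).\<close>

definition step_functions :: "'a set \<Rightarrow> (real \<Rightarrow> 'a) set" where
  "step_functions A = {f \<in> {0..<1} \<rightarrow>\<^sub>E A.
     \<exists>D. finite D \<and> (\<forall>s t. 0 \<le> s \<and> s \<le> t \<and> t < 1 \<and> {s<..t} \<inter> D = {} \<longrightarrow> f s = f t)}"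

definition step_dist :: "(real \<Rightarrow> 'a) \<Rightarrow> (real \<Rightarrow> 'a) \<Rightarrow> real" where
  "step_dist f g = measure lborel {t \<in> {0..<1}. f t \<noteq> g t}"

definition universal_space :: "('g, 'd) monoid_scheme \<Rightarrow> (real \<Rightarrow> 'g) topology" where
  "universal_space G = Metric_space.mtopology (step_functions (carrier G)) step_dist"

definition translate :: "('g, 'd) monoid_scheme \<Rightarrow> 'g \<Rightarrow> (real \<Rightarrow> 'g) \<Rightarrow> (real \<Rightarrow> 'g)" where
  "translate G g = (\<lambda>f \<in> step_functions (carrier G). \<lambda>t \<in> {0..<1}. g \<otimes>\<^bsub>G\<^esub> f t)"

definition quotient_topology :: "'a topology \<Rightarrow> ('a \<Rightarrow> 'b) \<Rightarrow> 'b topology" where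
  "quotient_topology X q =
     topology (\<lambda>U. U \<subseteq> q ` topspace X \<and> openin X {x \<in> topspace X. q x \<in> U})"

definition classifying_space :: "('g, 'd) monoid_scheme \<Rightarrow> (real \<Rightarrow> 'g) set topology" where
  "classifying_space G = quotient_topology (universal_space G) (orbit G (translate G))"

text \<open>The map \<open>BG \<rightarrow> BH\<close> induced by \<open>\<phi> : G \<rightarrow> H\<close> sends the orbit of \<open>f\<close> to the orbit of \<open>\<phi> \<circ> f\<close>.\<close>

definition classifying_map ::
    "('h, 'd) monoid_scheme \<Rightarrow> ('g \<Rightarrow> 'h) \<Rightarrow> (real \<Rightarrow> 'g) set \<Rightarrow> (real \<Rightarrow> 'h) set" where
  "classifying_map H \<phi> c = the_elem ((\<lambda>f. orbit H (translate H) (compose {0..<1} \<phi> f)) ` c)"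


section \<open>The complexity of a derivation\<close>

definition tc ::
    "('g, 'd) monoid_scheme \<Rightarrow> ('k, 'c) monoid_scheme \<Rightarrow> ('g \<Rightarrow> 'k \<Rightarrow> 'k) \<Rightarrow> ('g \<Rightarrow> 'k) \<Rightarrow> enat" where
  "tc G K \<phi> d = parametrized_cat (classifying_space (semidirect_product K G \<phi>))
     (classifying_map G snd)
     (classifying_map (semidirect_product K G \<phi>) (\<lambda>g. (d g, g)))"


section \<open>Basic properties\<close>

subsection \<open>Path spaces and fibrations\<close>

lemma topspace_path_space: "topspace (path_space X) = {\<alpha> \<in> extensional {0..1}. pathin X \<alpha>}"
proof -
  have "{\<alpha> \<in> extensional {0..1}. pathin X \<alpha>} \<in> {{\<alpha> \<in> extensional {0..1}. pathin X \<alpha> \<and> \<alpha> ` C \<subseteq> U} | C U.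
        compact C \<and> C \<subseteq> {0..1} \<and> openin X U}"
    by (rule CollectI, rule exI[of _ "{}"], rule exI[of _ "{}"]) auto
  then show ?thesis
    unfolding path_space_def topology_generated_by_topspace by (intro equalityI) auto
qed

lemma continuous_map_path_eval:
  "continuous_map (prod_topology (top_of_set {0..1}) (path_space X)) X (\<lambda>(t, \<alpha>). \<alpha> t)"
  unfolding continuous_map_def
proof (intro conjI allI impI)
  show "(\<lambda>(t, \<alpha>). \<alpha> t) \<in> topspace (prod_topology (top_of_set {0..1}) (path_space X)) \<rightarrow> topspace X"
    by (auto simp: topspace_path_space pathin_def continuous_map_def)
next
  fix U assume U: "openin X U"
  let ?P = "prod_topology (top_of_set {0..1::real}) (path_space X)"
  show "openin ?P {x \<in> topspace ?P. (case x of (t, \<alpha>) \<Rightarrow> \<alpha> t) \<in> U}"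
  proof (subst openin_subopen, intro ballI)
    fix x assume x: "x \<in> {x \<in> topspace ?P. (case x of (t, \<alpha>) \<Rightarrow> \<alpha> t) \<in> U}"
    obtain t \<alpha> where ta: "x = (t, \<alpha>)" by (cases x)
    have t: "t \<in> {0..1}" and a: "\<alpha> \<in> extensional {0..1}" "pathin X \<alpha>" and at: "\<alpha> t \<in> U"
      using x by (auto simp: ta topspace_path_space)
    have "openin (top_of_set {0..1}) {r \<in> {0..1}. \<alpha> r \<in> U}"
      using a(2) U unfolding pathin_def continuous_map_def by auto
    moreover have "t \<in> {r \<in> {0..1}. \<alpha> r \<in> U}" using t at by simp
    ultimately obtain e where e: "e > 0" and sub: "ball t e \<inter> {0..1} \<subseteq> {r \<in> {0..1}. \<alpha> r \<in> U}"
      unfolding openin_contains_ball by blast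
    define C where "C = cball t (e/2) \<inter> {0..1}"
    have C: "compact C" "C \<subseteq> {0..1}" by (auto simp: C_def intro: compact_Int)
    have aC: "\<alpha> ` C \<subseteq> U"
    proof
      fix y assume "y \<in> \<alpha> ` C"
      then obtain r where r: "y = \<alpha> r" "dist t r \<le> e/2" "r \<in> {0..1}" by (auto simp: C_def)
      then have "r \<in> ball t e \<inter> {0..1}" using e by simp
      then show "y \<in> U" using sub r(1) by blast
    qed
    define V where "V = {\<beta> \<in> extensional {0..1}. pathin X \<beta> \<and> \<beta> ` C \<subseteq> U}"
    have V: "openin (path_space X) V"
      unfolding path_space_def V_def using C U by (intro topology_generated_by_Basis) blast
    have W: "openin (top_of_set {0..1}) (ball t (e/2) \<inter> {0..1})"
      by (simp add: openin_open_Int Int_commute)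
    show "\<exists>T. openin ?P T \<and> x \<in> T \<and> T \<subseteq> {x \<in> topspace ?P. (case x of (t, \<alpha>) \<Rightarrow> \<alpha> t) \<in> U}"
    proof (intro exI conjI)
      show "openin ?P ((ball t (e/2) \<inter> {0..1}) \<times> V)"
        using V W by (simp add: openin_prod_Times_iff)
      show "x \<in> (ball t (e/2) \<inter> {0..1}) \<times> V"
        using t a aC e by (auto simp: ta V_def)
      show "(ball t (e/2) \<inter> {0..1}) \<times> V \<subseteq> {x \<in> topspace ?P. (case x of (t, \<alpha>) \<Rightarrow> \<alpha> t) \<in> U}"
        by (fastforce simp: V_def C_def topspace_path_space)
    qed
  qed
qed

lemma continuous_map_into_path_space:
  assumes H: "continuous_map (prod_topology (top_of_set {0..1}) Z) X H"
  shows "continuous_map Z (path_space X) (\<lambda>z. \<lambda>t \<in> {0..1}. H (t, z))"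
proof -
  have pth: "pathin X (\<lambda>t \<in> {0..1}. H (t, z))" if "z \<in> topspace Z" for z
  proof -
    have "continuous_map (top_of_set {0..1}) (prod_topology (top_of_set {0..1}) Z) (\<lambda>t. (t, z))"
      using that by (simp add: continuous_map_pairedI)
    then have "continuous_map (top_of_set {0..1}) X (H \<circ> (\<lambda>t. (t, z)))"
      using H continuous_map_compose by blast
    then show ?thesis
      unfolding pathin_def by (rule continuous_map_eq) auto
  qed
  show ?thesis
    unfolding path_space_def
  proof (rule continuous_on_generated_topo)
    fix S assume "S \<in> {{\<alpha> \<in> extensional {0..1}. pathin X \<alpha> \<and> \<alpha> ` C \<subseteq> U} | C U.
        compact C \<and> C \<subseteq> {0..1} \<and> openin X U}"
    then obtain C U where S: "S = {\<alpha> \<in> extensional {0..1}. pathin X \<alpha> \<and> \<alpha> ` C \<subseteq> U}"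
      and C: "compact C" "C \<subseteq> {0..1::real}" and U: "openin X U" by blast
    let ?W = "{p \<in> topspace (prod_topology (top_of_set {0..1}) Z). H p \<in> U}"
    have W: "openin (prod_topology (top_of_set {0..1}) Z) ?W"
      using H U unfolding continuous_map_def by blast
    have CI: "compactin (top_of_set {0..1}) C"
      using C by (simp add: compactin_subtopology)
    have eq: "(\<lambda>z. \<lambda>t\<in>{0..1}. H (t, z)) -` S \<inter> topspace Z = {z \<in> topspace Z. C \<times> {z} \<subseteq> ?W}"
    proof (intro Set.set_eqI)
      fix z
      have im: "(\<lambda>t\<in>{0..1}. H (t, z)) ` C \<subseteq> U \<longleftrightarrow> (\<forall>t\<in>C. H (t, z) \<in> U)"
        unfolding image_subset_iff using C(2) by (intro ball_cong) (auto simp: subset_eq)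
      then show "z \<in> (\<lambda>z. \<lambda>t\<in>{0..1}. H (t, z)) -` S \<inter> topspace Z \<longleftrightarrow>
          z \<in> {z \<in> topspace Z. C \<times> {z} \<subseteq> ?W}"
        using pth[of z] C(2) unfolding S vimage_eq Int_iff mem_Collect_eq im by auto
    qed
    show "openin Z ((\<lambda>z. \<lambda>t\<in>{0..1}. H (t, z)) -` S \<inter> topspace Z)"
      unfolding eq
    proof (subst openin_subopen, intro ballI)
      fix z assume z: "z \<in> {z \<in> topspace Z. C \<times> {z} \<subseteq> ?W}"
      then have zt: "z \<in> topspace Z" and zW: "C \<times> {z} \<subseteq> ?W" by blast+
      from zt have zc: "compactin Z {z}" by simp
      obtain A B where "openin Z B" "C \<subseteq> A" "{z} \<subseteq> B" "A \<times> B \<subseteq> ?W"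
        by (rule Wallace_theorem_prod_topology[OF CI zc W zW])
      moreover have "B \<subseteq> topspace Z" using \<open>openin Z B\<close> openin_subset by blast
      moreover have "C \<times> {z'} \<subseteq> ?W" if "z' \<in> B" for z'
      proof -
        have "C \<times> {z'} \<subseteq> A \<times> B" using that \<open>C \<subseteq> A\<close> by auto
        then show ?thesis using \<open>A \<times> B \<subseteq> ?W\<close> by (rule subset_trans)
      qed
      ultimately show "\<exists>T. openin Z T \<and> z \<in> T \<and> T \<subseteq> {z \<in> topspace Z. C \<times> {z} \<subseteq> ?W}"
      proof -
        assume a: "openin Z B" "{z} \<subseteq> B" "B \<subseteq> topspace Z" "\<And>z'. z' \<in> B \<Longrightarrow> C \<times> {z'} \<subseteq> ?W"
        have "B \<subseteq> {z \<in> topspace Z. C \<times> {z} \<subseteq> ?W}"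
          using a(3,4) by (intro subsetI CollectI conjI) auto
        then show ?thesis using a(1,2) by (intro exI[of _ B]) simp
      qed
    qed
  next
    have T: "\<Union> {{\<alpha> \<in> extensional {0..1}. pathin X \<alpha> \<and> \<alpha> ` C \<subseteq> U} | C U.
        compact C \<and> C \<subseteq> {0..1} \<and> openin X U} = {\<alpha> \<in> extensional {0..1}. pathin X \<alpha>}"
      using topspace_path_space[of X] unfolding path_space_def topology_generated_by_topspace .
    show "(\<lambda>z. \<lambda>t\<in>{0..1}. H (t, z)) ` topspace Z \<subseteq> \<Union> {{\<alpha> \<in> extensional {0..1}. pathin X \<alpha> \<and> \<alpha> ` C \<subseteq> U} | C U.
        compact C \<and> C \<subseteq> {0..1} \<and> openin X U}"
      unfolding T by (intro image_subsetI CollectI conjI restrict_extensional pth)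
  qed
qed

lemma fibration_homotopy_lifting:
  assumes "fibration E B q"
  shows "homotopy_lifting Z E B q"
  unfolding homotopy_lifting_def
proof (intro allI impI, elim conjE)
  fix f H
  assume f: "continuous_map Z E f"
    and H: "continuous_map (prod_topology (top_of_set {0..1::real}) Z) B H"
    and Hf: "\<forall>z\<in>topspace Z. H (0, z) = q (f z)"
  let ?I = "top_of_set {0..1::real}"
  define N where "N = subtopology (prod_topology E (path_space B)) {(e, \<gamma>). \<gamma> 0 = q e}"
  have lift: "homotopy_lifting N E B q" using assms by (simp add: fibration_def)
  have fstN: "continuous_map N E fst" and sndN: "continuous_map N (path_space B) snd"
    unfolding N_def by (auto intro: continuous_map_from_subtopology continuous_map_fst continuous_map_snd)
  have "continuous_map (prod_topology ?I N) (prod_topology ?I (path_space B)) (\<lambda>(t, x). (t, snd x))"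
    using sndN by (auto simp: continuous_map_prod_top)
  then have "continuous_map (prod_topology ?I N) B ((\<lambda>(t, \<alpha>). \<alpha> t) \<circ> (\<lambda>(t, x). (t, snd x)))"
    using continuous_map_path_eval continuous_map_compose by blast
  moreover have "((\<lambda>(t, \<alpha>). \<alpha> t) \<circ> (\<lambda>(t, x). (t, snd x))) = (\<lambda>(t::real, x::'a \<times> (real \<Rightarrow> 'b)). snd x t)"
    by auto
  ultimately have ev: "continuous_map (prod_topology ?I N) B (\<lambda>(t, x). snd x t)" by simp
  have N0: "\<forall>x \<in> topspace N. (\<lambda>(t, x). snd x t) (0, x) = q (fst x)" by (auto simp: N_def)
  obtain L where L: "continuous_map (prod_topology ?I N) E L"
    and L0: "\<And>x. x \<in> topspace N \<Longrightarrow> L (0, x) = fst x"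
    and Lq: "\<And>t x. t \<in> {0..1} \<Longrightarrow> x \<in> topspace N \<Longrightarrow> q (L (t, x)) = snd x t"
    using lift[unfolded homotopy_lifting_def, THEN spec[of _ fst],
        THEN spec[of _ "\<lambda>(t, x). snd x t"], THEN mp, OF conjI[OF fstN conjI[OF ev N0]]]
    by auto
  define j where "j z = (f z, \<lambda>t\<in>{0..1::real}. H (t, z))" for z
  have j: "continuous_map Z N j"
    unfolding N_def continuous_map_in_subtopology j_def
    using f continuous_map_into_path_space[OF H] Hf
    by (auto intro: continuous_map_pairedI)
  then have jN: "j z \<in> topspace N" if "z \<in> topspace Z" for z
    using that by (auto simp: continuous_map_def)
  have "continuous_map (prod_topology ?I Z) (prod_topology ?I N) (\<lambda>(t, z). (t, j z))"
    using j by (auto simp: continuous_map_prod_top)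
  then have "continuous_map (prod_topology ?I Z) E (L \<circ> (\<lambda>(t, z). (t, j z)))"
    using L continuous_map_compose by blast
  then show "\<exists>H'. continuous_map (prod_topology ?I Z) E H' \<and> (\<forall>z\<in>topspace Z. H' (0, z) = f z) \<and>
         (\<forall>t\<in>{0..1}. \<forall>z\<in>topspace Z. q (H' (t, z)) = H (t, z))"
    using L0 Lq jN by (intro exI[of _ "L \<circ> (\<lambda>(t, z). (t, j z))"]) (auto simp: j_def)
qed


subsection \<open>Semi-direct products\<close>

context
  fixes G :: "('g, 'd) monoid_scheme" and K :: "('k, 'c) monoid_scheme" and \<phi>
  assumes G: "group G" and K: "group K" and \<phi>: "\<phi> \<in> hom G (AutoGroup K)"
begin

lemma action_props:
  assumes "g \<in> carrier G" "h \<in> carrier G" "k \<in> carrier K" "l \<in> carrier K"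
  shows "\<phi> g k \<in> carrier K" "\<phi> g (k \<otimes>\<^bsub>K\<^esub> l) = \<phi> g k \<otimes>\<^bsub>K\<^esub> \<phi> g l"
    "\<phi> (g \<otimes>\<^bsub>G\<^esub> h) k = \<phi> g (\<phi> h k)"
proof -
  have a: "\<phi> g \<in> auto K" "\<phi> h \<in> auto K"
    using \<phi> assms by (auto simp: hom_def AutoGroup_def)
  then show "\<phi> g k \<in> carrier K" "\<phi> g (k \<otimes>\<^bsub>K\<^esub> l) = \<phi> g k \<otimes>\<^bsub>K\<^esub> \<phi> g l"
    using assms by (auto simp: auto_def hom_def)
  have "\<phi> (g \<otimes>\<^bsub>G\<^esub> h) = \<phi> g \<otimes>\<^bsub>AutoGroup K\<^esub> \<phi> h" using \<phi> assms by (auto simp: hom_def)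
  also have "\<dots> = compose (carrier K) (\<phi> g) (\<phi> h)"
    using a by (auto simp: AutoGroup_def BijGroup_def auto_def)
  finally show "\<phi> (g \<otimes>\<^bsub>G\<^esub> h) k = \<phi> g (\<phi> h k)" using assms by (simp add: compose_def)
qed

lemma action_one: "k \<in> carrier K \<Longrightarrow> \<phi> \<one>\<^bsub>G\<^esub> k = k"
proof -
  have "\<phi> \<one>\<^bsub>G\<^esub> = \<one>\<^bsub>AutoGroup K\<^esub>" using hom_one[OF \<phi> G group.AutoGroup[OF K]] .
  then show "k \<in> carrier K \<Longrightarrow> \<phi> \<one>\<^bsub>G\<^esub> k = k" by (simp add: AutoGroup_def BijGroup_def)
qed

lemma group_semidirect_product: "group (semidirect_product K G \<phi>)"
proof -
  interpret G: group G by (rule G)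
  interpret K: group K by (rule K)
  show ?thesis
  proof (rule groupI)
    fix x assume "x \<in> carrier (semidirect_product K G \<phi>)"
    then obtain k g where x: "x = (k, g)" "k \<in> carrier K" "g \<in> carrier G"
      by (auto simp: semidirect_product_def)
    have "\<phi> (inv\<^bsub>G\<^esub> g) (inv\<^bsub>K\<^esub> k) \<otimes>\<^bsub>K\<^esub> \<phi> (inv\<^bsub>G\<^esub> g) k = \<phi> (inv\<^bsub>G\<^esub> g) (inv\<^bsub>K\<^esub> k \<otimes>\<^bsub>K\<^esub> k)"
      using action_props(2)[of "inv\<^bsub>G\<^esub> g" g "inv\<^bsub>K\<^esub> k" k] x by simp
    also have "\<dots> = \<one>\<^bsub>K\<^esub>"
    proof -
      have "\<phi> (inv\<^bsub>G\<^esub> g) \<in> hom K K" using \<phi> x by (auto simp: hom_def AutoGroup_def auto_def)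
      then show ?thesis using hom_one[OF _ K K] x by simp
    qed
    finally show "\<exists>y\<in>carrier (semidirect_product K G \<phi>).
        y \<otimes>\<^bsub>semidirect_product K G \<phi>\<^esub> x = \<one>\<^bsub>semidirect_product K G \<phi>\<^esub>"
      using x action_props(1)[of "inv\<^bsub>G\<^esub> g" g "inv\<^bsub>K\<^esub> k" k]
      by (intro bexI[of _ "(\<phi> (inv\<^bsub>G\<^esub> g) (inv\<^bsub>K\<^esub> k), inv\<^bsub>G\<^esub> g)"]) (auto simp: semidirect_product_def)
  qed (auto simp: semidirect_product_def action_props action_one K.m_assoc G.m_assoc)
qed

lemma hom_semidirect_snd: "snd \<in> hom (semidirect_product K G \<phi>) G"
  by (auto simp: hom_def semidirect_product_def)

lemma hom_derivation_splitting:
  "derivation G K \<phi> d \<Longrightarrow> (\<lambda>g. (d g, g)) \<in> hom G (semidirect_product K G \<phi>)"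
  by (auto simp: hom_def semidirect_product_def derivation_def)

end


subsection \<open>The universal space\<close>

lemma step_functionsE:
  assumes "f \<in> step_functions A"
  obtains D where "finite D"
    "\<And>s t. 0 \<le> s \<Longrightarrow> s \<le> t \<Longrightarrow> t < 1 \<Longrightarrow> {s<..t} \<inter> D = {} \<Longrightarrow> f s = f t"
  using assms unfolding step_functions_def by blast

lemma step_set_measurable:
  assumes D: "finite D"
    and P: "\<And>s t. 0 \<le> s \<Longrightarrow> s \<le> t \<Longrightarrow> t < (1::real) \<Longrightarrow> {s<..t} \<inter> D = {} \<Longrightarrow> P s = P t"
  shows "{t \<in> {0..<1}. P t} \<in> sets lborel"
proof -
  define D' where "D' = insert 0 (D \<inter> {0..<1})"
  have D': "finite D'" "0 \<in> D'" "D' \<subseteq> {0..<1}" using D by (auto simp: D'_def)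
  have "{t \<in> {0..<1}. P t} =
      (\<Union>d \<in> {d \<in> D'. P d}. {0..<1} \<inter> {d..} \<inter> - (\<Union>d' \<in> {d' \<in> D'. d < d'}. {d'..}))" (is "_ = ?R")
  proof (intro Set.set_eqI iffI)
    fix t assume t: "t \<in> {t \<in> {0..<1}. P t}"
    define m where "m = Max {d \<in> D'. d \<le> t}"
    have ne: "finite {d \<in> D'. d \<le> t}" "{d \<in> D'. d \<le> t} \<noteq> {}" using D' t by auto
    then have m: "m \<in> D'" "m \<le> t" using Max_in[OF ne] by (auto simp: m_def)
    have mx: "d' > t" if "d' \<in> D'" "m < d'" for d'
      using that Max_ge[OF ne(1), of d'] by (force simp: m_def)
    have "{m<..t} \<inter> D = {}"
    proof (rule ccontr)
      assume "{m<..t} \<inter> D \<noteq> {}"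
      then obtain d' where "m < d'" "d' \<le> t" "d' \<in> D" by auto
      moreover then have "d' \<in> D'" using m D' t by (auto simp: D'_def)
      ultimately show False using mx by force
    qed
    then have "P m = P t" using P[of m t] m D' t by auto
    then show "t \<in> ?R" using t m mx by force
  next
    fix t assume "t \<in> ?R"
    then obtain d where d: "d \<in> D'" "P d" "t \<in> {0..<1}" "d \<le> t"
      and mx: "\<And>d'. d' \<in> D' \<Longrightarrow> d < d' \<Longrightarrow> t < d'" by force
    have "{d<..t} \<inter> D = {}"
    proof (rule ccontr)
      assume "{d<..t} \<inter> D \<noteq> {}"
      then obtain d' where "d < d'" "d' \<le> t" "d' \<in> D" by auto
      moreover then have "d' \<in> D'" using d D' by (auto simp: D'_def)
      ultimately show False using mx by force
    qed
    then have "P d = P t" using P[of d t] d D' by auto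
    then show "t \<in> {t \<in> {0..<1}. P t}" using d by auto
  qed
  also have "\<dots> \<in> sets lborel"
  proof -
    have "- (\<Union>d' \<in> {d' \<in> D'. d < d'}. {d'..}) \<in> sets borel" for d
    proof -
      have "(\<Union>d' \<in> {d' \<in> D'. d < d'}. {d'..}) \<in> sets borel"
        using D'(1) by (intro sets.finite_UN) auto
      then show ?thesis by (metis borel_comp)
    qed
    then show ?thesis using D'(1) by (simp, intro sets.finite_UN) auto
  qed
  finally show ?thesis .
qed

lemma step_neq_measurable:
  assumes "f \<in> step_functions A" "g \<in> step_functions A'"
  shows "{t \<in> {0..<1}. f t \<noteq> g t} \<in> sets lborel"
proof -
  obtain D where D: "finite D"
    "\<And>s t. 0 \<le> s \<Longrightarrow> s \<le> t \<Longrightarrow> t < 1 \<Longrightarrow> {s<..t} \<inter> D = {} \<Longrightarrow> f s = f t"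
    using assms(1) by (rule step_functionsE) blast
  obtain D' where D': "finite D'"
    "\<And>s t. 0 \<le> s \<Longrightarrow> s \<le> t \<Longrightarrow> t < 1 \<Longrightarrow> {s<..t} \<inter> D' = {} \<Longrightarrow> g s = g t"
    using assms(2) by (rule step_functionsE) blast
  show ?thesis
  proof (rule step_set_measurable[of "D \<union> D'"])
    fix s t :: real assume "0 \<le> s" "s \<le> t" "t < 1" "{s<..t} \<inter> (D \<union> D') = {}"
    then have "f s = f t" "g s = g t" using D(2)[of s t] D'(2)[of s t] by auto
    then show "(f s \<noteq> g s) = (f t \<noteq> g t)" by simp
  qed (use D D' in auto)
qed

lemma measure_unit_mono:
  fixes S T :: "real set"
  assumes "T \<in> sets lborel" "S \<subseteq> T" "T \<subseteq> {0..1}"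
  shows "measure lborel S \<le> measure lborel T"
proof (cases "S \<in> sets lborel")
  case True
  have "emeasure lborel T \<le> emeasure lborel {0..1::real}"
    using assms by (intro emeasure_mono) auto
  then have "T \<in> fmeasurable lborel" using assms by (auto simp: fmeasurable_def less_top[symmetric] top_unique)
  then show ?thesis using True assms by (intro measure_mono_fmeasurable) auto
next
  case False
  then show ?thesis by (simp add: measure_notin_sets)
qed

lemma step_dist_triangle:
  assumes "f \<in> step_functions A" "g \<in> step_functions A" "h \<in> step_functions A"
  shows "step_dist f h \<le> step_dist f g + step_dist g h"
proof -
  have "step_dist f h \<le> measure lborel ({t \<in> {0..<1}. f t \<noteq> g t} \<union> {t \<in> {0..<1}. g t \<noteq> h t})"
    unfolding step_dist_def using assms
    by (intro measure_unit_mono sets.Un step_neq_measurable) auto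
  also have "\<dots> \<le> step_dist f g + step_dist g h"
    unfolding step_dist_def using assms
    by (intro measure_Un_le step_neq_measurable)
  finally show ?thesis .
qed

lemma step_dist_zero_imp_eq:
  assumes f: "f \<in> step_functions A" and g: "g \<in> step_functions A" and "step_dist f g = 0"
  shows "f = g"
proof (rule ccontr)
  assume "f \<noteq> g"
  then obtain t where t: "t \<in> {0..<1}" "f t \<noteq> g t"
    using f g unfolding step_functions_def by (metis (no_types, lifting) PiE_ext mem_Collect_eq)
  obtain D where D: "finite D"
    "\<And>s t. 0 \<le> s \<Longrightarrow> s \<le> t \<Longrightarrow> t < 1 \<Longrightarrow> {s<..t} \<inter> D = {} \<Longrightarrow> f s = f t"
    using f by (rule step_functionsE) blast
  obtain D' where D': "finite D'"
    "\<And>s t. 0 \<le> s \<Longrightarrow> s \<le> t \<Longrightarrow> t < 1 \<Longrightarrow> {s<..t} \<inter> D' = {} \<Longrightarrow> g s = g t"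
    using g by (rule step_functionsE) blast
  define u where "u = Min (insert 1 {d \<in> D \<union> D'. t < d})"
  have fin: "finite (insert 1 {d \<in> D \<union> D'. t < d})" using D D' by auto
  have u: "t < u" "u \<le> 1" using t fin by (auto simp: u_def)
  have "u \<le> d" if "d \<in> D \<union> D'" "t < d" for d using fin that by (auto simp: u_def)
  then have e: "{t<..s} \<inter> D = {}" "{t<..s} \<inter> D' = {}" if "s < u" for s using that by force+
  have "{t..<u} \<subseteq> {t \<in> {0..<1}. f t \<noteq> g t}"
  proof
    fix s assume "s \<in> {t..<u}"
    then have "f t = f s" "g t = g s" using D(2)[of t s] D'(2)[of t s] e[of s] t u by auto
    then show "s \<in> {t \<in> {0..<1}. f t \<noteq> g t}" using t u \<open>s \<in> {t..<u}\<close> by auto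
  qed
  then have "measure lborel {t..<u} \<le> step_dist f g"
    unfolding step_dist_def using f g by (intro measure_unit_mono step_neq_measurable) auto
  then show False using u assms(3) by simp
qed

lemma Metric_space_step_functions: "Metric_space (step_functions A) step_dist"
proof
  show "step_dist f g = 0 \<longleftrightarrow> f = g" if "f \<in> step_functions A" "g \<in> step_functions A" for f g
    using step_dist_zero_imp_eq[OF that] by (auto simp: step_dist_def)
  show "step_dist f g = step_dist g f" for f g :: "real \<Rightarrow> 'a"
    by (simp add: step_dist_def eq_commute)
qed (auto intro: step_dist_triangle, simp add: step_dist_def)

lemma topspace_universal_space: "topspace (universal_space G) = step_functions (carrier G)"
  unfolding universal_space_def
  using Metric_space.topspace_mtopology[OF Metric_space_step_functions] .

lemma step_functions_compose:
  assumes "f \<in> step_functions A" "h \<in> A \<rightarrow> B"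
  shows "compose {0..<1} h f \<in> step_functions B"
proof -
  obtain D where D: "finite D"
    "\<And>s t. 0 \<le> s \<Longrightarrow> s \<le> t \<Longrightarrow> t < 1 \<Longrightarrow> {s<..t} \<inter> D = {} \<Longrightarrow> f s = f t"
    using assms(1) by (rule step_functionsE) blast
  have "f t \<in> A" if "t \<in> {0..<1}" for t
    using assms(1) that by (auto simp: step_functions_def)
  then have "compose {0..<1} h f \<in> {0..<1} \<rightarrow>\<^sub>E B"
    using assms(2) by (auto simp: compose_def)
  moreover have "compose {0..<1} h f s = compose {0..<1} h f t"
    if "0 \<le> s \<and> s \<le> t \<and> t < 1 \<and> {s<..t} \<inter> D = {}" for s t
    using that D(2)[of s t] by (simp add: compose_def)
  ultimately show ?thesis unfolding step_functions_def using D(1) by blast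
qed

lemma step_dist_compose_le:
  assumes "f \<in> step_functions A" "g \<in> step_functions A"
  shows "step_dist (compose {0..<1} h f) (compose {0..<1} h g) \<le> step_dist f g"
  unfolding step_dist_def using assms
  by (intro measure_unit_mono step_neq_measurable) (auto simp: compose_def)

lemma translate_eq:
  "f \<in> step_functions (carrier G) \<Longrightarrow> translate G g f = compose {0..<1} (\<lambda>x. g \<otimes>\<^bsub>G\<^esub> x) f"
  by (simp add: translate_def compose_def)

context group
begin

lemma translate_closed:
  "g \<in> carrier G \<Longrightarrow> f \<in> step_functions (carrier G) \<Longrightarrow> translate G g f \<in> step_functions (carrier G)"
  by (auto simp: translate_eq intro: step_functions_compose)

lemma step_value: "f \<in> step_functions (carrier G) \<Longrightarrow> 0 \<le> t \<Longrightarrow> t < 1 \<Longrightarrow> f t \<in> carrier G"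
  by (auto simp: step_functions_def)

lemma translate_mult:
  assumes "g \<in> carrier G" "h \<in> carrier G" "f \<in> step_functions (carrier G)"
  shows "translate G (g \<otimes> h) f = translate G g (translate G h f)"
  using assms translate_closed[of h f] step_value[of f]
  by (auto simp: translate_def m_assoc restrict_def fun_eq_iff)

lemma translate_one:
  assumes "f \<in> step_functions (carrier G)"
  shows "translate G \<one> f = f"
  using assms step_value[of f]
  by (auto simp: translate_def restrict_def fun_eq_iff step_functions_def PiE_def extensional_def)

lemma group_action_translate: "group_action G (step_functions (carrier G)) (translate G)"
proof (intro group_action.intro group_hom.intro group_hom_axioms.intro homI)
  let ?E = "step_functions (carrier G)"
  have bij: "translate G g \<in> Bij ?E" if g: "g \<in> carrier G" for g
  proof -
    have "bij_betw (translate G g) ?E ?E"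
    proof (rule bij_betwI[where g = "translate G (inv g)"])
      show "translate G (inv g) (translate G g f) = f" "translate G g (translate G (inv g) f) = f"
        if "f \<in> ?E" for f
        using that g by (simp_all flip: translate_mult add: translate_one)
    qed (use g in \<open>auto intro: translate_closed\<close>)
    then show ?thesis by (auto simp: Bij_def translate_def)
  qed
  then show "translate G g \<in> carrier (BijGroup ?E)" if "g \<in> carrier G" for g
    using that by (simp add: BijGroup_def)
  show "translate G (g \<otimes> h) = translate G g \<otimes>\<^bsub>BijGroup ?E\<^esub> translate G h"
    if "g \<in> carrier G" "h \<in> carrier G" for g h
  proof -
    have "translate G (g \<otimes> h) f = compose ?E (translate G g) (translate G h) f" for f
      using translate_mult[OF that, of f] by (cases "f \<in> ?E") (auto simp: compose_def translate_def)
    then show ?thesis using that bij by (auto simp: BijGroup_def)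
  qed
qed (auto intro: group_BijGroup)

lemma step_dist_translate:
  assumes "g \<in> carrier G" "f \<in> step_functions (carrier G)" "f' \<in> step_functions (carrier G)"
  shows "step_dist (translate G g f) (translate G g f') = step_dist f f'"
  unfolding step_dist_def using assms step_value
  by (intro arg_cong[where f = "measure lborel"]) (auto simp: translate_def)

lemma step_dist_translate_self:
  assumes "g \<in> carrier G" "g \<noteq> \<one>" "f \<in> step_functions (carrier G)"
  shows "step_dist (translate G g f) f = 1"
proof -
  have "{t \<in> {0..<1}. translate G g f t \<noteq> f t} = {0..<1}"
    using assms step_value[of f] by (auto simp: translate_def)
  then show ?thesis by (simp add: step_dist_def)
qed

text \<open>At time \<open>s\<close> the contraction replaces the values of a step function on \<open>[0,s)\<close> by the unit.\<close>

lemma contractible_universal_space: "contractible_space (universal_space G)"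
proof -
  let ?E = "step_functions (carrier G)" and ?I = "top_of_set {0..1::real}"
  interpret E: Metric_space ?E step_dist by (rule Metric_space_step_functions)
  define h where "h = (\<lambda>(s::real, f). \<lambda>t\<in>{0..<1::real}. if t < s then \<one> else f t)"
  have closed: "h (s, f) \<in> ?E" if f: "f \<in> ?E" for s f
  proof -
    obtain D where D: "finite D"
      "\<And>s t. 0 \<le> s \<Longrightarrow> s \<le> t \<Longrightarrow> t < 1 \<Longrightarrow> {s<..t} \<inter> D = {} \<Longrightarrow> f s = f t"
      using f by (rule step_functionsE) blast
    have "h (s, f) u = h (s, f) v" if "0 \<le> u \<and> u \<le> v \<and> v < 1 \<and> {u<..v} \<inter> insert s D = {}" for u v
    proof -
      have "f u = f v" using that D(2)[of u v] by auto
      moreover have "u < s \<longleftrightarrow> v < s" using that by (auto simp: not_less)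
      ultimately show ?thesis using that by (simp add: h_def)
    qed
    moreover have "h (s, f) \<in> {0..<1} \<rightarrow>\<^sub>E carrier G" using f step_value[of f] by (auto simp: h_def)
    moreover have "finite (insert s D)" using D by simp
    ultimately show ?thesis unfolding step_functions_def by blast
  qed
  have bound: "step_dist (h (s, f)) (h (s', f')) \<le> \<bar>s - s'\<bar> + step_dist f f'"
    if "f \<in> ?E" "f' \<in> ?E" "s \<in> {0..1}" "s' \<in> {0..1}" for s s' f f'
  proof -
    let ?A = "{min s s'..<max s s'}" and ?B = "{t \<in> {0..<1}. f t \<noteq> f' t}"
    have B: "?B \<in> sets lborel" using that by (intro step_neq_measurable)
    have "{t \<in> {0..<1}. h (s, f) t \<noteq> h (s', f') t} \<subseteq> ?A \<union> ?B"
    proof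
      fix t assume t: "t \<in> {t \<in> {0..<1}. h (s, f) t \<noteq> h (s', f') t}"
      show "t \<in> ?A \<union> ?B"
      proof (cases "t < s \<longleftrightarrow> t < s'")
        case True
        then have "f t \<noteq> f' t" using t by (cases "t < s") (auto simp: h_def)
        then show ?thesis using t by simp
      next
        case False
        then have "t \<in> ?A" by (auto simp: min_def max_def)
        then show ?thesis by simp
      qed
    qed
    moreover have "?A \<union> ?B \<subseteq> {0..1}" using that(3,4) by auto
    ultimately have "step_dist (h (s, f)) (h (s', f')) \<le> measure lborel (?A \<union> ?B)"
      unfolding step_dist_def using B by (intro measure_unit_mono) simp_all
    also have "\<dots> \<le> measure lborel ?A + measure lborel ?B" using B by (intro measure_Un_le) auto
    also have "measure lborel ?A = \<bar>s - s'\<bar>" by (simp add: max_def min_def)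
    finally show ?thesis by (simp add: step_dist_def)
  qed
  have cont: "continuous_map (prod_topology ?I E.mtopology) E.mtopology h"
    unfolding E.continuous_map_to_metric
  proof (intro ballI allI impI)
    fix x and e :: real assume e: "e > 0" and x: "x \<in> topspace (prod_topology ?I E.mtopology)"
    obtain s f where sf: "x = (s, f)" by (cases x)
    have s: "s \<in> {0..1}" and f: "f \<in> ?E" using x by (auto simp: sf)
      show "\<exists>U. openin (prod_topology ?I E.mtopology) U \<and> x \<in> U \<and> (\<forall>y\<in>U. h y \<in> E.mball (h x) e)"
      proof (intro exI conjI)
        show "openin (prod_topology ?I E.mtopology) (({0..1} \<inter> ball s (e/2)) \<times> E.mball f (e/2))"
          by (simp add: openin_prod_Times_iff openin_open_Int)
        show "x \<in> ({0..1} \<inter> ball s (e/2)) \<times> E.mball f (e/2)" using s f e by (simp add: sf)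
        show "\<forall>y\<in>({0..1} \<inter> ball s (e/2)) \<times> E.mball f (e/2). h y \<in> E.mball (h x) e"
        proof safe
          fix s' f' assume a: "s' \<in> {0..1}" "s' \<in> ball s (e/2)" "f' \<in> E.mball f (e/2)"
          then have "step_dist (h (s, f)) (h (s', f')) < e"
            using bound[OF f _ s, of f' s'] by (auto simp: dist_real_def)
          then show "h (s', f') \<in> E.mball (h x) e" using a f closed by (simp add: sf)
        qed
      qed
  qed
  have "homotopic_with (\<lambda>_. True) E.mtopology E.mtopology id (\<lambda>_. \<lambda>t\<in>{0..<1}. \<one>)"
  proof (subst homotopic_with, simp, intro exI conjI)
    show "continuous_map (prod_topology ?I E.mtopology) E.mtopology h" by (rule cont)
    show "\<forall>x\<in>topspace E.mtopology. h (0, x) = id x"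
      unfolding E.topspace_mtopology
      by (auto simp: h_def restrict_def fun_eq_iff step_functions_def PiE_def extensional_def)
    show "\<forall>x\<in>topspace E.mtopology. h (1, x) = (\<lambda>t\<in>{0..<1}. \<one>)"
      by (auto simp: h_def restrict_def fun_eq_iff)
  qed auto
  then show ?thesis unfolding contractible_space_def universal_space_def by blast
qed

end


subsection \<open>The classifying space functor\<close>

lemma quotient_map_quotient_topology: "quotient_map X (quotient_topology X q) q"
proof -
  have "istopology (\<lambda>U. U \<subseteq> q ` topspace X \<and> openin X {x \<in> topspace X. q x \<in> U})"
    unfolding istopology_def
  proof (intro conjI allI impI)
    fix S T assume "S \<subseteq> q ` topspace X \<and> openin X {x \<in> topspace X. q x \<in> S}"
      and "T \<subseteq> q ` topspace X \<and> openin X {x \<in> topspace X. q x \<in> T}"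
    moreover have "{x \<in> topspace X. q x \<in> S \<inter> T} =
        {x \<in> topspace X. q x \<in> S} \<inter> {x \<in> topspace X. q x \<in> T}" by auto
    ultimately show "openin X {x \<in> topspace X. q x \<in> S \<inter> T}" by auto
  next
    fix \<K> assume "\<forall>K\<in>\<K>. K \<subseteq> q ` topspace X \<and> openin X {x \<in> topspace X. q x \<in> K}"
    moreover have "{x \<in> topspace X. q x \<in> \<Union>\<K>} = (\<Union>K\<in>\<K>. {x \<in> topspace X. q x \<in> K})" by auto
    ultimately show "openin X {x \<in> topspace X. q x \<in> \<Union>\<K>}" by auto
  qed auto
  then have op: "openin (quotient_topology X q) U \<longleftrightarrow>
      U \<subseteq> q ` topspace X \<and> openin X {x \<in> topspace X. q x \<in> U}" for U
    by (simp add: quotient_topology_def topology_inverse')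
  have "{x \<in> topspace X. q x \<in> q ` topspace X} = topspace X" by auto
  then have "openin (quotient_topology X q) (q ` topspace X)" by (simp add: op)
  then have "topspace (quotient_topology X q) = q ` topspace X"
    using op by (metis openin_subset openin_topspace subset_antisym)
  then show ?thesis by (auto simp: quotient_map_def op)
qed

lemma quotient_map_classifying_space:
  "quotient_map (universal_space G) (classifying_space G) (orbit G (translate G))"
  unfolding classifying_space_def by (rule quotient_map_quotient_topology)

lemma topspace_classifying_space:
  "topspace (classifying_space G) = orbits G (step_functions (carrier G)) (translate G)"
proof -
  have "topspace (classifying_space G) = orbit G (translate G) ` step_functions (carrier G)"
    using quotient_map_classifying_space[of G]
    by (simp add: quotient_map_def topspace_universal_space)
  then show ?thesis by (auto simp: orbits_def)
qed

lemma orbit_translate_eq: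
  assumes "group G" "f \<in> step_functions (carrier G)" "f' \<in> orbit G (translate G) f"
  shows "orbit G (translate G) f' = orbit G (translate G) f"
proof -
  interpret group_action G "step_functions (carrier G)" "translate G"
    using assms(1) by (rule group.group_action_translate)
  have cl: "y \<in> step_functions (carrier G)"
    if "x \<in> step_functions (carrier G)" "y \<in> orbit G (translate G) x" for x y
    using that group.translate_closed[OF assms(1)] by (auto simp: orbit_def)
  have f': "f' \<in> step_functions (carrier G)" using cl assms by blast
  show ?thesis
  proof (intro equalityI subsetI)
    show "x \<in> orbit G (translate G) f" if "x \<in> orbit G (translate G) f'" for x
      using orbit_trans[OF assms(2) f' _ assms(3) that] cl[OF f' that] .
    show "x \<in> orbit G (translate G) f'" if "x \<in> orbit G (translate G) f" for x
      using orbit_trans[OF f' assms(2) _ orbit_sym[OF assms(2) f' assms(3)] that]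
        cl[OF assms(2) that] .
  qed
qed

lemma compose_translate:
  assumes "h \<in> hom G H" "g \<in> carrier G" "f \<in> step_functions (carrier G)"
  shows "compose {0..<1} h (translate G g f) = translate H (h g) (compose {0..<1} h f)"
proof -
  have h: "h \<in> carrier G \<rightarrow> carrier H" using assms(1) by (auto simp: hom_def)
  have "f t \<in> carrier G" if "0 \<le> t" "t < 1" for t using assms(3) that by (auto simp: step_functions_def)
  then show ?thesis
    using assms step_functions_compose[OF assms(3) h]
    by (auto simp: translate_eq compose_def hom_mult restrict_def fun_eq_iff)
qed

lemma classifying_map_orbit:
  assumes G: "group G" and H: "group H" and h: "h \<in> hom G H" and f: "f \<in> step_functions (carrier G)"
  shows "classifying_map H h (orbit G (translate G) f) = orbit H (translate H) (compose {0..<1} h f)"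
proof -
  have hf: "compose {0..<1} h f \<in> step_functions (carrier H)"
    using f h by (intro step_functions_compose) (auto simp: hom_def)
  have "orbit H (translate H) (compose {0..<1} h f') = orbit H (translate H) (compose {0..<1} h f)"
    if f': "f' \<in> orbit G (translate G) f" for f'
  proof -
    obtain g where g: "g \<in> carrier G" "f' = translate G g f" using f' by (auto simp: orbit_def)
    then have "compose {0..<1} h f' = translate H (h g) (compose {0..<1} h f)"
      using compose_translate[OF h _ f] by simp
    then have "compose {0..<1} h f' \<in> orbit H (translate H) (compose {0..<1} h f)"
      using g h by (auto simp: orbit_def hom_def)
    then show ?thesis using orbit_translate_eq[OF H hf] by blast
  qed
  moreover have "f \<in> orbit G (translate G) f"
    using group_action.orbit_refl[OF group.group_action_translate[OF G] f] .
  ultimately show ?thesis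
    unfolding classifying_map_def by (intro the_elem_image_unique) blast+
qed

lemma continuous_map_classifying_map:
  assumes G: "group G" and H: "group H" and h: "h \<in> hom G H"
  shows "continuous_map (classifying_space G) (classifying_space H) (classifying_map H h)"
proof (rule continuous_compose_quotient_map[OF quotient_map_classifying_space])
  let ?EG = "step_functions (carrier G)" and ?EH = "step_functions (carrier H)"
  have h': "h \<in> carrier G \<rightarrow> carrier H" using h by (auto simp: hom_def)
  interpret EG: Metric_space ?EG step_dist by (rule Metric_space_step_functions)
  interpret EH: Metric_space ?EH step_dist by (rule Metric_space_step_functions)
  have "continuous_map EG.mtopology EH.mtopology (compose {0..<1} h)"
    unfolding EG.metric_continuous_map[OF Metric_space_step_functions]
  proof (intro conjI ballI allI impI)
    show "compose {0..<1} h ` ?EG \<subseteq> ?EH" using step_functions_compose[OF _ h'] by auto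
    fix f and e :: real assume "f \<in> ?EG" "0 < e"
    then show "\<exists>\<delta>>0. \<forall>x. x \<in> ?EG \<and> step_dist f x < \<delta> \<longrightarrow>
        step_dist (compose {0..<1} h f) (compose {0..<1} h x) < e"
      using step_dist_compose_le[of f "carrier G" _ h] by (meson order.strict_trans1)
  qed
  then have "continuous_map (universal_space G) (classifying_space H)
      (orbit H (translate H) \<circ> compose {0..<1} h)"
    unfolding universal_space_def[of G]
    using quotient_imp_continuous_map[OF quotient_map_classifying_space[of H]]
    by (metis continuous_map_compose universal_space_def)
  then show "continuous_map (universal_space G) (classifying_space H)
      (classifying_map H h \<circ> orbit G (translate G))"
    by (rule continuous_map_eq) (simp add: topspace_universal_space classifying_map_orbit[OF G H h])
qed

lemma classifying_map_id:
  assumes "group G" "c \<in> topspace (classifying_space G)"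
  shows "classifying_map G id c = c"
proof -
  obtain f where f: "f \<in> step_functions (carrier G)" "c = orbit G (translate G) f"
    using assms(2) by (auto simp: topspace_classifying_space orbits_def)
  have "compose {0..<1} id f = f"
    using f(1) by (auto simp: step_functions_def compose_def PiE_def extensional_restrict)
  moreover have "id \<in> hom G G" by (auto simp: hom_def)
  ultimately show ?thesis using classifying_map_orbit[OF assms(1,1) _ f(1)] by (simp add: f(2))
qed

lemma classifying_map_comp:
  assumes "group G" "group H" "group L" "h \<in> hom G H" "l \<in> hom H L"
    and "c \<in> topspace (classifying_space G)"
  shows "classifying_map L (l \<circ> h) c = classifying_map L l (classifying_map H h c)"
proof -
  obtain f where f: "f \<in> step_functions (carrier G)" "c = orbit G (translate G) f"
    using assms(6) by (auto simp: topspace_classifying_space orbits_def)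
  have hf: "compose {0..<1} h f \<in> step_functions (carrier H)"
    using f assms(4) by (intro step_functions_compose) (auto simp: hom_def)
  have "l \<circ> h \<in> hom G L" using assms(4,5) by (rule Group.hom_compose)
  moreover have "compose {0..<1} (l \<circ> h) f = compose {0..<1} l (compose {0..<1} h f)"
    by (auto simp: compose_def)
  ultimately show ?thesis
    using assms f(1) hf by (simp add: f(2) classifying_map_orbit[where G = G] classifying_map_orbit[where G = H])
qed

end

theory Submission
  imports Defs
begin

text \<open>
  Both invariants measure how far two maps are from being homotopic. For maps \<open>g, h : Z \<rightarrow> B\<close> let the
  homotopic distance \<open>D(g, h)\<close> be the least \<open>n\<close> such that \<open>Z\<close> is covered by \<open>n + 1\<close> open sets on each
  of which \<open>g\<close> and \<open>h\<close> are homotopic (Macias-Virgos and Mosquera-Lois).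

  A section of \<open>\<alpha> \<mapsto> (\<alpha>(0), f(\<alpha>(1)))\<close> over \<open>U \<subseteq> X \<times> Y\<close> becomes, after composition with \<open>f\<close>, a homotopy
  on \<open>U\<close> from \<open>f \<circ> pr\<^sub>1\<close> to \<open>pr\<^sub>2\<close>. If \<open>f\<close> is a fibration, every such homotopy arises in this way: lift it
  to \<open>X\<close>, starting at \<open>pr\<^sub>1\<close>. Hence \<open>TC(f) = D(f \<circ> pr\<^sub>1, pr\<^sub>2)\<close> (lemma \<open>TC_map_eq_homotopic_distance\<close>).

  If \<open>G\<close> acts trivially on \<open>K\<close>, then \<open>K \<rtimes> G\<close> is the direct product, \<open>d\<close> is a homomorphism, and
  \<open>B(K \<rtimes> G)\<close> is homeomorphic to \<open>BG \<times> BK\<close> (lemma \<open>homeomorphic_map_classifying_space_product\<close>). Under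
  this homeomorphism \<open>Bp\<close> is the first projection and \<open>B(s\<^sub>d)\<close> is the graph of \<open>Bd\<close>. A path in a fibre of
  \<open>Bp\<close> that starts on the section is thus a point \<open>b\<close> of \<open>BG\<close> with a path in \<open>BK\<close> that starts at
  \<open>Bd(b)\<close>, so that \<open>tc(d) = D(Bd \<circ> pr\<^sub>1, pr\<^sub>2)\<close> on \<open>BG \<times> BK\<close>
  (lemma \<open>parametrized_cat_eq_homotopic_distance\<close>).

  It remains to pass from \<open>Bd\<close> to the fibration \<open>f\<close>. The homotopic distance does not increase under
  composition on either side, nor does it change when the maps are replaced by homotopic ones (lemma
  \<open>homotopic_distance_le\<close>); composing with the homotopy equivalences \<open>X \<simeq> BG\<close> and \<open>Y \<simeq> BK\<close> and with
  their homotopy inverses gives the two inequalities.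
\<close>

section \<open>The homotopic distance\<close>

definition homotopic_distance ::
    "'z topology \<Rightarrow> 'b topology \<Rightarrow> ('z \<Rightarrow> 'b) \<Rightarrow> ('z \<Rightarrow> 'b) \<Rightarrow> enat" where
  "homotopic_distance Z B g h = Inf (enat ` {n. \<exists>U :: nat \<Rightarrow> 'z set.
     (\<Union>i\<le>n. U i) = topspace Z \<and>
     (\<forall>i\<le>n. openin Z (U i) \<and> homotopic_with (\<lambda>_. True) (subtopology Z (U i)) B g h)})"

lemma secat_eq_homotopic_distance:
  assumes "\<And>U. openin Z U \<Longrightarrow>
    (\<exists>s. continuous_map (subtopology Z U) E s \<and> (\<forall>z \<in> U. q (s z) = z)) \<longleftrightarrow>
    homotopic_with (\<lambda>_. True) (subtopology Z U) B g h"
  shows "secat E Z q = homotopic_distance Z B g h"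
proof -
  have "(openin Z U \<and> (\<exists>s. continuous_map (subtopology Z U) E s \<and> (\<forall>z \<in> U. q (s z) = z))) \<longleftrightarrow>
      (openin Z U \<and> homotopic_with (\<lambda>_. True) (subtopology Z U) B g h)" for U
    using assms by blast
  then show ?thesis by (simp add: secat_def homotopic_distance_def)
qed

text \<open>The preimages under \<open>k\<close> of the open sets of a cover for \<open>g\<close> and \<open>h\<close> form a cover for \<open>w \<circ> g \<circ> k\<close>
  and \<open>w \<circ> h \<circ> k\<close>.\<close>

lemma homotopic_distance_le:
  assumes k: "continuous_map Z' Z k" and w: "continuous_map B B' w"
    and g: "homotopic_with (\<lambda>_. True) Z' B' g' (w \<circ> (g \<circ> k))"
    and h: "homotopic_with (\<lambda>_. True) Z' B' h' (w \<circ> (h \<circ> k))"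
  shows "homotopic_distance Z' B' g' h' \<le> homotopic_distance Z B g h"
  unfolding homotopic_distance_def
proof (rule Inf_superset_mono, rule image_mono, rule subsetI)
  fix n
  assume "n \<in> {n. \<exists>U :: nat \<Rightarrow> _. (\<Union>i\<le>n. U i) = topspace Z \<and>
     (\<forall>i\<le>n. openin Z (U i) \<and> homotopic_with (\<lambda>_. True) (subtopology Z (U i)) B g h)}"
  from CollectD[OF this] obtain U where U: "(\<Union>i\<le>n. U i) = topspace Z"
    "\<And>i. i \<le> n \<Longrightarrow> openin Z (U i)"
    "\<And>i. i \<le> n \<Longrightarrow> homotopic_with (\<lambda>_. True) (subtopology Z (U i)) B g h"
    by metis
  define V where "V i = {z \<in> topspace Z'. k z \<in> U i}" for i
  have "(\<Union>i\<le>n. V i) = topspace Z'"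
  proof -
    have "(\<Union>i\<le>n. V i) = {z \<in> topspace Z'. k z \<in> (\<Union>i\<le>n. U i)}" by (auto simp: V_def)
    then show ?thesis using continuous_map_image_subset_topspace[OF k] by (auto simp: U(1))
  qed
  moreover have "openin Z' (V i) \<and> homotopic_with (\<lambda>_. True) (subtopology Z' (V i)) B' g' h'"
    if i: "i \<le> n" for i
  proof
    show "openin Z' (V i)"
      unfolding V_def using k U(2)[OF i] by (rule openin_continuous_map_preimage)
    have incl: "continuous_map (subtopology Z' (V i)) Z' id"
      by (simp add: continuous_map_from_subtopology)
    have "continuous_map (subtopology Z' (V i)) (subtopology Z (U i)) k"
      using k by (auto simp: continuous_map_in_subtopology continuous_map_from_subtopology V_def)
    then have "homotopic_with (\<lambda>_. True) (subtopology Z' (V i)) B' (w \<circ> (g \<circ> k)) (w \<circ> (h \<circ> k))"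
      by (intro homotopic_with_compose_continuous_map_left[OF _ w]
          homotopic_with_compose_continuous_map_right[OF U(3)[OF i]]) simp_all
    moreover have "homotopic_with (\<lambda>_. True) (subtopology Z' (V i)) B' g' (w \<circ> (g \<circ> k))"
      using homotopic_with_compose_continuous_map_right[OF g incl] by simp
    moreover have "homotopic_with (\<lambda>_. True) (subtopology Z' (V i)) B' (w \<circ> (h \<circ> k)) h'"
      using homotopic_with_compose_continuous_map_right[OF homotopic_with_symD[OF h] incl] by simp
    ultimately show "homotopic_with (\<lambda>_. True) (subtopology Z' (V i)) B' g' h'"
      using homotopic_with_trans by blast
  qed
  ultimately show "n \<in> {n. \<exists>U. (\<Union>i\<le>n. U i) = topspace Z' \<and>
     (\<forall>i\<le>n. openin Z' (U i) \<and> homotopic_with (\<lambda>_. True) (subtopology Z' (U i)) B' g' h')}"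
    by (intro CollectI exI[of _ V]) simp
qed


section \<open>Path-space invariants as homotopic distances\<close>

lemma continuous_map_path_uncurry:
  assumes "continuous_map Z (path_space X) s"
  shows "continuous_map (prod_topology (top_of_set {0..1}) Z) X (\<lambda>(t, z). s z t)"
proof -
  have "continuous_map (prod_topology (top_of_set {0..1}) Z)
      (prod_topology (top_of_set {0..1}) (path_space X)) (\<lambda>(t, z). (t, s z))"
    using assms by (auto simp: continuous_map_prod_top)
  from continuous_map_compose[OF this continuous_map_path_eval] show ?thesis
    by (rule continuous_map_eq) auto
qed

lemma homotopic_with_True:
  "homotopic_with (\<lambda>_. True) Z B g h \<longleftrightarrow>
    (\<exists>H. continuous_map (prod_topology (top_of_set {0..1::real}) Z) B H \<and>
      (\<forall>z \<in> topspace Z. H (0, z) = g z) \<and> (\<forall>z \<in> topspace Z. H (1, z) = h z))"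
  by (subst homotopic_with) simp_all

text \<open>The path \<open>s(x, y)\<close> runs in \<open>X\<close> from \<open>x\<close> to a point over \<open>y\<close>, so \<open>f\<close> maps it to a path from \<open>f(x)\<close> to
  \<open>y\<close>. The homotopy lifting property recovers such an \<open>s\<close> from the paths in \<open>Y\<close>.\<close>

lemma TC_map_eq_homotopic_distance:
  assumes f: "fibration X Y f"
  shows "TC_map X Y f = homotopic_distance (prod_topology X Y) Y (f \<circ> fst) snd"
  unfolding TC_map_def
proof (rule secat_eq_homotopic_distance)
  fix U assume "openin (prod_topology X Y) U"
  then have U: "U \<subseteq> topspace (prod_topology X Y)" by (rule openin_subset)
  define Z where "Z = subtopology (prod_topology X Y) U"
  have Z: "topspace Z = U" using U by (auto simp: Z_def)
  have cf: "continuous_map X Y f" using f by (simp add: fibration_def)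
  show "(\<exists>s. continuous_map (subtopology (prod_topology X Y) U) (path_space X) s \<and>
        (\<forall>b\<in>U. (s b 0, f (s b 1)) = b)) \<longleftrightarrow>
      homotopic_with (\<lambda>_. True) (subtopology (prod_topology X Y) U) Y (f \<circ> fst) snd"
    unfolding Z_def[symmetric]
  proof
    assume "\<exists>s. continuous_map Z (path_space X) s \<and> (\<forall>b\<in>U. (s b 0, f (s b 1)) = b)"
    then obtain s where s: "continuous_map Z (path_space X) s"
      and sb: "\<And>b. b \<in> U \<Longrightarrow> s b 0 = fst b \<and> f (s b 1) = snd b"
      by (metis fst_conv snd_conv)
    show "homotopic_with (\<lambda>_. True) Z Y (f \<circ> fst) snd"
      unfolding homotopic_with_True
      using continuous_map_compose[OF continuous_map_path_uncurry[OF s] cf] sb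
      by (intro exI[of _ "f \<circ> (\<lambda>(t, z). s z t)"]) (auto simp: Z)
  next
    assume "homotopic_with (\<lambda>_. True) Z Y (f \<circ> fst) snd"
    then obtain H where H: "continuous_map (prod_topology (top_of_set {0..1::real}) Z) Y H"
      "\<And>z. z \<in> U \<Longrightarrow> H (0, z) = f (fst z)" "\<And>z. z \<in> U \<Longrightarrow> H (1, z) = snd z"
      by (auto simp: homotopic_with_True Z)
    have "continuous_map Z X fst"
      by (simp add: Z_def continuous_map_from_subtopology continuous_map_fst)
    then obtain L where L: "continuous_map (prod_topology (top_of_set {0..1::real}) Z) X L"
      and "\<forall>z \<in> topspace Z. L (0, z) = fst z"
      and "\<forall>t \<in> {0..1}. \<forall>z \<in> topspace Z. f (L (t, z)) = H (t, z)"
      using fibration_homotopy_lifting[OF f, of Z] H(1,2) unfolding homotopy_lifting_def Z by blast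
    then show "\<exists>s. continuous_map Z (path_space X) s \<and> (\<forall>b\<in>U. (s b 0, f (s b 1)) = b)"
      using H(3) continuous_map_into_path_space[OF L]
      by (intro exI[of _ "\<lambda>z. \<lambda>t\<in>{0..1}. L (t, z)"]) (auto simp: Z)
  qed
qed

text \<open>If \<open>q\<close> is, up to the homeomorphism \<open>(q, r)\<close>, the projection of a product \<open>A \<times> B\<close>, then a path in a
  fibre of \<open>q\<close> is determined by its second coordinate, and a section \<open>s\<close> is the graph of \<open>r \<circ> s\<close>.\<close>

lemma parametrized_cat_eq_homotopic_distance:
  assumes qr: "homeomorphic_map W (prod_topology A B) (\<lambda>w. (q w, r w))"
    and s: "\<And>a. a \<in> topspace A \<Longrightarrow> s a \<in> topspace W \<and> q (s a) = a"
  shows "parametrized_cat W q s = homotopic_distance W B (r \<circ> (s \<circ> q)) r"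
  unfolding parametrized_cat_def
proof (rule secat_eq_homotopic_distance)
  fix U assume "openin W U"
  then have U: "U \<subseteq> topspace W" by (rule openin_subset)
  define Z where "Z = subtopology W U"
  have Z: "topspace Z = U" using U by (auto simp: Z_def)
  have "continuous_map W (prod_topology A B) (\<lambda>w. (q w, r w))"
    using qr by (rule homeomorphic_imp_continuous_map)
  then have q: "continuous_map W A q" and r: "continuous_map W B r"
    by (simp_all add: continuous_map_pairwise o_def)
  have qA: "q w \<in> topspace A" if "w \<in> topspace W" for w
    using q that by (auto simp: continuous_map_def)
  obtain p where p: "homeomorphic_maps W (prod_topology A B) (\<lambda>w. (q w, r w)) p"
    using qr by (auto simp: homeomorphic_map_maps)
  then have cp: "continuous_map (prod_topology A B) W p"
    and pqr: "\<And>w. w \<in> topspace W \<Longrightarrow> p (q w, r w) = w"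
    and qrp: "\<And>a b. a \<in> topspace A \<Longrightarrow> b \<in> topspace B \<Longrightarrow> q (p (a, b)) = a \<and> r (p (a, b)) = b"
    by (auto simp: homeomorphic_maps_def)
  show "(\<exists>\<sigma>. continuous_map (subtopology W U) (fibre_path_space W q s) \<sigma> \<and> (\<forall>w\<in>U. \<sigma> w 1 = w)) \<longleftrightarrow>
      homotopic_with (\<lambda>_. True) (subtopology W U) B (r \<circ> (s \<circ> q)) r"
    unfolding Z_def[symmetric]
  proof
    assume "\<exists>\<sigma>. continuous_map Z (fibre_path_space W q s) \<sigma> \<and> (\<forall>w\<in>U. \<sigma> w 1 = w)"
    then obtain \<sigma> where cont: "continuous_map Z (fibre_path_space W q s) \<sigma>"
      and end1: "\<And>w. w \<in> U \<Longrightarrow> \<sigma> w 1 = w"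
      by blast
    have \<sigma>: "continuous_map Z (path_space W) \<sigma>"
      using cont by (simp add: fibre_path_space_def continuous_map_in_subtopology)
    have fib: "(\<exists>b. \<forall>t \<in> {0..1}. q (\<sigma> w t) = b) \<and> \<sigma> w 0 = s (q (\<sigma> w 0))" if "w \<in> U" for w
    proof -
      have "\<sigma> w \<in> topspace (fibre_path_space W q s)"
        using continuous_map_image_subset_topspace[OF cont] that by (auto simp: Z)
      then show ?thesis by (simp add: fibre_path_space_def)
    qed
    have "\<sigma> w 0 = s (q w)" if w: "w \<in> U" for w
    proof -
      obtain b where "\<forall>t \<in> {0..1}. q (\<sigma> w t) = b" using fib[OF w] by blast
      then have "q (\<sigma> w 0) = q (\<sigma> w 1)" by simp
      then show ?thesis using fib[OF w] end1[OF w] by simp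
    qed
    then show "homotopic_with (\<lambda>_. True) Z B (r \<circ> (s \<circ> q)) r"
      unfolding homotopic_with_True
      using continuous_map_compose[OF continuous_map_path_uncurry[OF \<sigma>] r] end1
      by (intro exI[of _ "r \<circ> (\<lambda>(t, z). \<sigma> z t)"]) (auto simp: Z)
  next
    assume "homotopic_with (\<lambda>_. True) Z B (r \<circ> (s \<circ> q)) r"
    then obtain H where H: "continuous_map (prod_topology (top_of_set {0..1::real}) Z) B H"
      and H0: "\<And>z. z \<in> U \<Longrightarrow> H (0, z) = r (s (q z))" and H1: "\<And>z. z \<in> U \<Longrightarrow> H (1, z) = r z"
      by (auto simp: homotopic_with_True Z)
    \<comment> \<open>In the coordinates \<open>(q, r)\<close>, the path at \<open>z\<close> is constant in \<open>A\<close> and follows \<open>H\<close> in \<open>B\<close>.\<close>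
    define L where "L = p \<circ> (\<lambda>x. (q (snd x), H x))"
    have "continuous_map Z A q" using q by (simp add: Z_def continuous_map_from_subtopology)
    then have "continuous_map (prod_topology (top_of_set {0..1::real}) Z) A (q \<circ> snd)"
      using continuous_map_snd continuous_map_compose by blast
    then have L: "continuous_map (prod_topology (top_of_set {0..1::real}) Z) W L"
      unfolding L_def using H cp
      by (intro continuous_map_compose[OF _ cp] continuous_map_pairedI) (simp_all add: o_def)
    have HB: "H (t, z) \<in> topspace B" if "t \<in> {0..1}" "z \<in> U" for t z
      using H that by (auto simp: continuous_map_def Z Pi_iff)
    have qL: "q (L (t, z)) = q z" if "t \<in> {0..1}" "z \<in> U" for t z
      using qrp[of "q z" "H (t, z)"] HB[OF that] qA that U by (auto simp: L_def)
    have L0: "L (0, z) = s (q z)" if "z \<in> U" for z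
      using pqr[of "s (q z)"] s[OF qA] H0[OF that] that U by (auto simp: L_def)
    have L1: "L (1, z) = z" if "z \<in> U" for z
      using pqr[of z] H1[OF that] that U by (auto simp: L_def)
    define \<sigma> where "\<sigma> z = (\<lambda>t\<in>{0..1::real}. L (t, z))" for z
    have "continuous_map Z (path_space W) \<sigma>"
      unfolding \<sigma>_def by (rule continuous_map_into_path_space[OF L])
    moreover have "(\<exists>b. \<forall>t \<in> {0..1}. q (\<sigma> z t) = b) \<and> \<sigma> z 0 = s (q (\<sigma> z 0))" if "z \<in> U" for z
      using qL[OF _ that] L0[OF that] qL[of 0, OF _ that] by (auto simp: \<sigma>_def)
    ultimately have "continuous_map Z (fibre_path_space W q s) \<sigma>"
      by (auto simp: fibre_path_space_def continuous_map_in_subtopology Z)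
    then show "\<exists>\<sigma>. continuous_map Z (fibre_path_space W q s) \<sigma> \<and> (\<forall>w\<in>U. \<sigma> w 1 = w)"
      using L1 by (auto simp: \<sigma>_def)
  qed
qed


section \<open>The classifying space of a product\<close>

text \<open>A group acts on its universal space by isometries, so the union of the translates of an open
  set is open.\<close>

lemma open_map_orbit_translate:
  assumes G: "group G"
  shows "open_map (universal_space G) (classifying_space G) (orbit G (translate G))"
  unfolding open_map_def
proof (intro allI impI)
  let ?E = "step_functions (carrier G)" and ?o = "orbit G (translate G)"
  interpret group G by (rule G)
  interpret E: Metric_space ?E step_dist by (rule Metric_space_step_functions)
  interpret act: group_action G ?E "translate G" by (rule group_action_translate)
  fix N assume N: "openin (universal_space G) N"
  then have NE: "N \<subseteq> ?E" using openin_subset topspace_universal_space by metis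
  have "openin (universal_space G) {x \<in> ?E. ?o x \<in> ?o ` N}"
    unfolding universal_space_def E.openin_mtopology
  proof (intro conjI allI impI)
    fix x assume "x \<in> {x \<in> ?E. ?o x \<in> ?o ` N}"
    then obtain y where x: "x \<in> ?E" and y: "y \<in> N" "?o x = ?o y" by auto
    have "y \<in> ?o x" using act.orbit_refl[of y] y NE by auto
    then obtain g where g: "g \<in> carrier G" "y = translate G g x" by (auto simp: orbit_def)
    obtain e where e: "e > 0" "E.mball y e \<subseteq> N"
      using N y(1) by (auto simp: universal_space_def E.openin_mtopology)
    have "E.mball x e \<subseteq> {x \<in> ?E. ?o x \<in> ?o ` N}"
    proof
      fix z assume "z \<in> E.mball x e"
      then have z: "z \<in> ?E" "step_dist x z < e" by auto
      then have "translate G g z \<in> E.mball y e"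
        using g x by (simp add: translate_closed step_dist_translate)
      then have "translate G g z \<in> N" using e by blast
      moreover have "?o (translate G g z) = ?o z"
        by (rule orbit_translate_eq[OF G z(1)]) (use g(1) in \<open>auto simp: orbit_def\<close>)
      ultimately show "z \<in> {x \<in> ?E. ?o x \<in> ?o ` N}" using z(1) by (metis (mono_tags) imageI mem_Collect_eq)
    qed
    then show "\<exists>e>0. E.mball x e \<subseteq> {x \<in> ?E. ?o x \<in> ?o ` N}" using e(1) by blast
  qed auto
  moreover have "?o ` N \<subseteq> topspace (classifying_space G)"
    using NE by (auto simp: topspace_classifying_space orbits_def)
  ultimately show "openin (classifying_space G) (?o ` N)"
    using quotient_map_classifying_space[of G]
    by (simp add: quotient_map_def topspace_universal_space)
qed

lemma step_functions_pair:
  assumes "a \<in> step_functions A" "b \<in> step_functions B"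
  shows "(\<lambda>t\<in>{0..<1}. (a t, b t)) \<in> step_functions (A \<times> B)"
proof -
  obtain D where D: "finite D"
    "\<And>s t. 0 \<le> s \<Longrightarrow> s \<le> t \<Longrightarrow> t < 1 \<Longrightarrow> {s<..t} \<inter> D = {} \<Longrightarrow> a s = a t"
    using assms(1) by (rule step_functionsE) blast
  obtain D' where D': "finite D'"
    "\<And>s t. 0 \<le> s \<Longrightarrow> s \<le> t \<Longrightarrow> t < 1 \<Longrightarrow> {s<..t} \<inter> D' = {} \<Longrightarrow> b s = b t"
    using assms(2) by (rule step_functionsE) blast
  have "(\<lambda>t\<in>{0..<1}. (a t, b t)) s = (\<lambda>t\<in>{0..<1}. (a t, b t)) t"
    if "0 \<le> s \<and> s \<le> t \<and> t < 1 \<and> {s<..t} \<inter> (D \<union> D') = {}" for s t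
    using that D(2)[of s t] D'(2)[of s t] by (auto simp: Int_Un_distrib)
  moreover have "(\<lambda>t\<in>{0..<1}. (a t, b t)) \<in> {0..<1} \<rightarrow>\<^sub>E A \<times> B"
    using assms by (auto simp: step_functions_def)
  moreover have "finite (D \<union> D')" using D(1) D'(1) by simp
  ultimately show ?thesis unfolding step_functions_def by blast
qed

lemma step_dist_pair_le:
  assumes "a \<in> step_functions A" "b \<in> step_functions B" "a' \<in> step_functions A" "b' \<in> step_functions B"
  shows "step_dist (\<lambda>t\<in>{0..<1}. (a t, b t)) (\<lambda>t\<in>{0..<1}. (a' t, b' t)) \<le>
    step_dist a a' + step_dist b b'"
proof -
  have "step_dist (\<lambda>t\<in>{0..<1}. (a t, b t)) (\<lambda>t\<in>{0..<1}. (a' t, b' t)) \<le>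
      measure lborel ({t \<in> {0..<1}. a t \<noteq> a' t} \<union> {t \<in> {0..<1}. b t \<noteq> b' t})"
    unfolding step_dist_def using assms
    by (intro measure_unit_mono sets.Un step_neq_measurable) auto
  also have "\<dots> \<le> step_dist a a' + step_dist b b'"
    unfolding step_dist_def using assms by (intro measure_Un_le step_neq_measurable)
  finally show ?thesis .
qed

context
  fixes G :: "('g, 'd) monoid_scheme" and K :: "('k, 'c) monoid_scheme" and \<phi>
  assumes G: "group G" and K: "group K" and \<phi>: "\<phi> \<in> hom G (AutoGroup K)"
    and trivial: "\<forall>g \<in> carrier G. \<forall>k \<in> carrier K. \<phi> g k = k"
begin

lemma group_direct: "group (semidirect_product K G \<phi>)"
  using group_semidirect_product[OF G K \<phi>] .

lemma hom_fst_direct: "fst \<in> hom (semidirect_product K G \<phi>) K"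
  using trivial by (auto simp: hom_def semidirect_product_def)

lemma hom_snd_direct: "snd \<in> hom (semidirect_product K G \<phi>) G"
  using hom_semidirect_snd[OF G K \<phi>] .

text \<open>A step function into \<open>K \<times> G\<close> is a pair of step functions, and its distance from another one is at
  most the sum of the distances of the components. Hence a ball in the universal space of \<open>K \<rtimes> G\<close>
  contains the pairs from a product of balls, and since orbit maps are open, the bijection from orbits of pairs to
  pairs of orbits is open.\<close>

lemma homeomorphic_map_classifying_space_product:
  "homeomorphic_map (classifying_space (semidirect_product K G \<phi>))
     (prod_topology (classifying_space G) (classifying_space K))
     (\<lambda>c. (classifying_map G snd c, classifying_map K fst c))"
proof (rule bijective_open_imp_homeomorphic_map)
  let ?S = "semidirect_product K G \<phi>"
  let ?W = "classifying_space ?S" and ?A = "classifying_space G" and ?B = "classifying_space K"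
  let ?ES = "step_functions (carrier ?S)" and ?EG = "step_functions (carrier G)"
    and ?EK = "step_functions (carrier K)"
  let ?oS = "orbit ?S (translate ?S)" and ?oG = "orbit G (translate G)" and ?oK = "orbit K (translate K)"
  let ?\<Psi> = "\<lambda>c. (classifying_map G snd c, classifying_map K fst c)"
  let ?pair = "\<lambda>a b. \<lambda>t\<in>{0..<1::real}. (a t, b t)"
  have carS: "carrier ?S = carrier K \<times> carrier G" by (simp add: semidirect_product_def)
  interpret ES: Metric_space ?ES step_dist by (rule Metric_space_step_functions)
  interpret EG: Metric_space ?EG step_dist by (rule Metric_space_step_functions)
  interpret EK: Metric_space ?EK step_dist by (rule Metric_space_step_functions)
  have topW: "topspace ?W = ?oS ` ?ES" and topA: "topspace ?A = ?oG ` ?EG"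
    and topB: "topspace ?B = ?oK ` ?EK"
    by (auto simp: topspace_classifying_space orbits_def)
  have closed: "?pair a b \<in> ?ES" if "a \<in> ?EK" "b \<in> ?EG" for a b
    using step_functions_pair[OF that] by (simp add: carS)
  have \<Psi>: "?\<Psi> (?oS (?pair a b)) = (?oG b, ?oK a)" if a: "a \<in> ?EK" and b: "b \<in> ?EG" for a b
  proof -
    have "compose {0..<1} fst (?pair a b) = a" "compose {0..<1} snd (?pair a b) = b"
      using a b
      by (auto simp: step_functions_def compose_def restrict_def fun_eq_iff PiE_def extensional_def)
    then show ?thesis
      using classifying_map_orbit[OF group_direct K hom_fst_direct closed[OF a b]]
        classifying_map_orbit[OF group_direct G hom_snd_direct closed[OF a b]] by simp
  qed
  have split: "\<exists>a\<in>?EK. \<exists>b\<in>?EG. f = ?pair a b" if f: "f \<in> ?ES" for f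
  proof (intro bexI)
    show "compose {0..<1} fst f \<in> ?EK" "compose {0..<1} snd f \<in> ?EG"
      using f by (auto intro!: step_functions_compose simp: carS)
    show "f = ?pair (compose {0..<1} fst f) (compose {0..<1} snd f)"
      using f by (auto simp: step_functions_def compose_def restrict_def fun_eq_iff PiE_def extensional_def)
  qed
  show "continuous_map ?W (prod_topology ?A ?B) ?\<Psi>"
    using continuous_map_classifying_map[OF group_direct G hom_snd_direct]
      continuous_map_classifying_map[OF group_direct K hom_fst_direct]
    by (rule continuous_map_pairedI)
  show "open_map ?W (prod_topology ?A ?B) ?\<Psi>"
    unfolding open_map_def
  proof (intro allI impI)
    fix V assume V: "openin ?W V"
    have VW: "V \<subseteq> ?oS ` ?ES" using openin_subset[OF V] by (simp add: topW)
    have V': "openin ES.mtopology {f \<in> ?ES. ?oS f \<in> V}"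
      using quotient_map_classifying_space[of ?S] V VW
      unfolding quotient_map_def topspace_universal_space by (simp add: universal_space_def)
    show "openin (prod_topology ?A ?B) (?\<Psi> ` V)"
    proof (subst openin_subopen, intro ballI)
      fix x assume "x \<in> ?\<Psi> ` V"
      then obtain a b where a: "a \<in> ?EK" and b: "b \<in> ?EG" and ab: "?oS (?pair a b) \<in> V"
        and x: "x = (?oG b, ?oK a)"
        using VW split \<Psi> by blast
      obtain e where e: "e > 0" "ES.mball (?pair a b) e \<subseteq> {f \<in> ?ES. ?oS f \<in> V}"
        using V' ab closed[OF a b] unfolding ES.openin_mtopology by blast
      let ?T = "?oG ` EG.mball b (e/2) \<times> ?oK ` EK.mball a (e/2)"
      have "openin ?A (?oG ` EG.mball b (e/2))" "openin ?B (?oK ` EK.mball a (e/2))"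
        using open_map_orbit_translate[OF G] open_map_orbit_translate[OF K]
        by (simp_all add: open_map_def universal_space_def)
      then have "openin (prod_topology ?A ?B) ?T" by (simp add: openin_prod_Times_iff)
      moreover have "x \<in> ?T" using a b e(1) by (auto simp: x)
      moreover have "?T \<subseteq> ?\<Psi> ` V"
      proof clarify
        fix b' a' assume "b' \<in> EG.mball b (e/2)" "a' \<in> EK.mball a (e/2)"
        then have a': "a' \<in> ?EK" "step_dist a a' < e/2" and b': "b' \<in> ?EG" "step_dist b b' < e/2"
          by auto
        have "step_dist (?pair a b) (?pair a' b') < e"
          using step_dist_pair_le[OF a b a'(1) b'(1)] a' b' by simp
        then have "?pair a' b' \<in> ES.mball (?pair a b) e"
          using closed[OF a b] closed[OF a'(1) b'(1)] by simp
        then have "?oS (?pair a' b') \<in> V" using e(2) by blast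
        then show "(?oG b', ?oK a') \<in> ?\<Psi> ` V"
          by (rule rev_image_eqI) (simp only: \<Psi>[OF a'(1) b'(1)])
      qed
      ultimately show "\<exists>T. openin (prod_topology ?A ?B) T \<and> x \<in> T \<and> T \<subseteq> ?\<Psi> ` V" by blast
    qed
  qed
  show "?\<Psi> ` topspace ?W = topspace (prod_topology ?A ?B)"
  proof
    show "?\<Psi> ` topspace ?W \<subseteq> topspace (prod_topology ?A ?B)"
    proof
      fix x assume "x \<in> ?\<Psi> ` topspace ?W"
      then obtain a b where "a \<in> ?EK" "b \<in> ?EG" "x = (?oG b, ?oK a)"
        using split \<Psi> unfolding topW by blast
      then show "x \<in> topspace (prod_topology ?A ?B)" by (simp add: topA topB)
    qed
    show "topspace (prod_topology ?A ?B) \<subseteq> ?\<Psi> ` topspace ?W"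
    proof
      fix x assume "x \<in> topspace (prod_topology ?A ?B)"
      then obtain a b where ab: "a \<in> ?EK" "b \<in> ?EG" "x = (?oG b, ?oK a)"
        by (auto simp: topA topB)
      then show "x \<in> ?\<Psi> ` topspace ?W"
        unfolding topW by (intro rev_image_eqI[OF imageI[OF closed[OF ab(1,2)]]]) (simp only: \<Psi>[OF ab(1,2)])
    qed
  qed
  show "inj_on ?\<Psi> (topspace ?W)"
  proof (rule inj_onI)
    fix c c' assume c: "c \<in> topspace ?W" "c' \<in> topspace ?W" and eq: "?\<Psi> c = ?\<Psi> c'"
    obtain a b where ab: "a \<in> ?EK" "b \<in> ?EG" "c = ?oS (?pair a b)"
      using c(1) split unfolding topW by blast
    obtain a' b' where ab': "a' \<in> ?EK" "b' \<in> ?EG" "c' = ?oS (?pair a' b')"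
      using c(2) split unfolding topW by blast
    have "?oK a = ?oK a'" "?oG b = ?oG b'"
      using eq \<Psi>[OF ab(1,2)] \<Psi>[OF ab'(1,2)] ab(3) ab'(3) by auto
    then have "a' \<in> ?oK a" "b' \<in> ?oG b"
      using group_action.orbit_refl[OF group.group_action_translate[OF K] ab'(1)]
        group_action.orbit_refl[OF group.group_action_translate[OF G] ab'(2)] by auto
    then obtain k g where k: "k \<in> carrier K" "a' = translate K k a"
      and g: "g \<in> carrier G" "b' = translate G g b"
      by (auto simp: orbit_def)
    have "?pair a' b' = translate ?S (k, g) (?pair a b)"
      using closed[OF ab(1,2)] ab(1,2) k g trivial group.step_value[OF K ab(1)]
      by (auto simp: translate_def semidirect_product_def restrict_def fun_eq_iff)
    then have "?pair a' b' \<in> ?oS (?pair a b)"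
      using k(1) g(1) by (auto simp: orbit_def carS)
    then show "c = c'"
      using orbit_translate_eq[OF group_direct closed[OF ab(1,2)]] ab(3) ab'(3) by simp
  qed
qed

lemma tc_eq_homotopic_distance:
  assumes d: "derivation G K \<phi> d"
  shows "tc G K \<phi> d = homotopic_distance (classifying_space (semidirect_product K G \<phi>)) (classifying_space K)
    (classifying_map K d \<circ> classifying_map G snd) (classifying_map K fst)"
proof -
  let ?S = "semidirect_product K G \<phi>"
  let ?A = "classifying_space G" and ?W = "classifying_space ?S"
  let ?q = "classifying_map G snd" and ?r = "classifying_map K fst"
    and ?s = "classifying_map ?S (\<lambda>g. (d g, g))"
  have sd: "(\<lambda>g. (d g, g)) \<in> hom G ?S" using hom_derivation_splitting[OF G K \<phi> d] .
  have cs: "continuous_map ?A ?W ?s" using continuous_map_classifying_map[OF G group_direct sd] .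
  have qs: "?q (?s a) = a" if a: "a \<in> topspace ?A" for a
    using classifying_map_comp[OF G group_direct G sd hom_snd_direct a] classifying_map_id[OF G a]
    by (simp add: o_def id_def)
  have rs: "?r (?s a) = classifying_map K d a" if "a \<in> topspace ?A" for a
    using classifying_map_comp[OF G group_direct K sd hom_fst_direct that] by (simp add: o_def)
  have "?s a \<in> topspace ?W \<and> ?q (?s a) = a" if "a \<in> topspace ?A" for a
    using cs qs that by (auto simp: continuous_map_def)
  from parametrized_cat_eq_homotopic_distance[OF homeomorphic_map_classifying_space_product this]
  have "tc G K \<phi> d = homotopic_distance ?W (classifying_space K) (?r \<circ> (?s \<circ> ?q)) ?r"
    by (simp add: tc_def)
  also have "\<dots> = homotopic_distance ?W (classifying_space K) (classifying_map K d \<circ> ?q) ?r"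
  proof -
    have q: "continuous_map ?W ?A ?q" using continuous_map_classifying_map[OF group_direct G hom_snd_direct] .
    have "?r (?s (?q c)) = classifying_map K d (?q c)" if "c \<in> topspace ?W" for c
      using rs q that by (auto simp: continuous_map_def)
    then have "homotopic_with (\<lambda>_. True) (subtopology ?W U) B (?r \<circ> (?s \<circ> ?q)) h \<longleftrightarrow>
        homotopic_with (\<lambda>_. True) (subtopology ?W U) B (classifying_map K d \<circ> ?q) h" for U B h
      unfolding homotopic_with_True by simp
    then show ?thesis by (simp add: homotopic_distance_def)
  qed
  finally show ?thesis .
qed

end


section \<open>The complexity of a derivation for a trivial action\<close>

text \<open>For a product \<open>W \<cong> A \<times> B\<close> with projections \<open>q\<close> and \<open>r\<close>, the distance of \<open>g \<circ> q\<close> and \<open>r\<close> depends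
  only on the homotopy type of the map \<open>g : A \<rightarrow> B\<close>: with homotopy inverses \<open>u'\<close> and \<open>v'\<close> of \<open>u\<close> and
  \<open>v\<close>, we have \<open>g \<simeq> v \<circ> f \<circ> u'\<close> and \<open>f \<simeq> v' \<circ> g \<circ> u\<close>.\<close>

lemma homotopic_distance_homotopy_equivalent:
  assumes qr: "homeomorphic_map W (prod_topology A B) (\<lambda>w. (q w, r w))"
    and f: "continuous_map X Y f" and g: "continuous_map A B g"
    and u: "homotopy_equivalence_map X A u" and v: "homotopy_equivalence_map Y B v"
    and vf: "homotopic_with (\<lambda>_. True) X B (v \<circ> f) (g \<circ> u)"
  shows "homotopic_distance W B (g \<circ> q) r = homotopic_distance (prod_topology X Y) Y (f \<circ> fst) snd"
proof -
  obtain u' where cu: "continuous_map X A u" and cu': "continuous_map A X u'"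
    and uu': "homotopic_with (\<lambda>_. True) A A (u \<circ> u') id"
    using u unfolding homotopy_equivalence_map_def by blast
  obtain v' where cv: "continuous_map Y B v" and cv': "continuous_map B Y v'"
    and v'v: "homotopic_with (\<lambda>_. True) Y Y (v' \<circ> v) id"
    and vv': "homotopic_with (\<lambda>_. True) B B (v \<circ> v') id"
    using v unfolding homotopy_equivalence_map_def by blast
  have "continuous_map W (prod_topology A B) (\<lambda>w. (q w, r w))"
    using qr by (rule homeomorphic_imp_continuous_map)
  then have q: "continuous_map W A q" and r: "continuous_map W B r"
    by (simp_all add: continuous_map_pairwise o_def)
  obtain p where "homeomorphic_maps W (prod_topology A B) (\<lambda>w. (q w, r w)) p"
    using qr by (auto simp: homeomorphic_map_maps)
  then have cp: "continuous_map (prod_topology A B) W p"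
    and qrp: "\<And>a b. a \<in> topspace A \<Longrightarrow> b \<in> topspace B \<Longrightarrow> q (p (a, b)) = a \<and> r (p (a, b)) = b"
    by (auto simp: homeomorphic_maps_def)
  have g_eq: "homotopic_with (\<lambda>_. True) A B g (v \<circ> f \<circ> u')"
  proof -
    have "homotopic_with (\<lambda>_. True) A B (g \<circ> (u \<circ> u')) (g \<circ> id)"
      using homotopic_with_compose_continuous_map_left[OF uu' g] by simp
    moreover have "homotopic_with (\<lambda>_. True) A B (v \<circ> f \<circ> u') (g \<circ> u \<circ> u')"
      using homotopic_with_compose_continuous_map_right[OF vf cu'] by simp
    ultimately show ?thesis
      by (metis comp_assoc comp_id homotopic_with_symD homotopic_with_trans)
  qed
  have f_eq: "homotopic_with (\<lambda>_. True) X Y f (v' \<circ> (g \<circ> u))"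
  proof -
    have "homotopic_with (\<lambda>_. True) X Y (v' \<circ> v \<circ> f) (id \<circ> f)"
      using homotopic_with_compose_continuous_map_right[OF v'v f] by simp
    moreover have "homotopic_with (\<lambda>_. True) X Y (v' \<circ> (v \<circ> f)) (v' \<circ> (g \<circ> u))"
      using homotopic_with_compose_continuous_map_left[OF vf cv'] by simp
    ultimately show ?thesis
      by (metis comp_assoc id_comp homotopic_with_symD homotopic_with_trans)
  qed
  show ?thesis
  proof (rule antisym)
    show "homotopic_distance W B (g \<circ> q) r \<le> homotopic_distance (prod_topology X Y) Y (f \<circ> fst) snd"
    proof (rule homotopic_distance_le)
      show "continuous_map W (prod_topology X Y) (\<lambda>w. ((u' \<circ> q) w, (v' \<circ> r) w))"
        using q r cu' cv' by (intro continuous_map_pairedI continuous_map_compose) simp_all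
      show "continuous_map Y B v" by (rule cv)
      show "homotopic_with (\<lambda>_. True) W B (g \<circ> q) (v \<circ> (f \<circ> fst \<circ> (\<lambda>w. ((u' \<circ> q) w, (v' \<circ> r) w))))"
        using homotopic_with_compose_continuous_map_right[OF g_eq q] by (simp add: o_def)
      show "homotopic_with (\<lambda>_. True) W B r (v \<circ> (snd \<circ> (\<lambda>w. ((u' \<circ> q) w, (v' \<circ> r) w))))"
        using homotopic_with_compose_continuous_map_right[OF homotopic_with_symD[OF vv'] r]
        by (simp add: o_def)
    qed
    show "homotopic_distance (prod_topology X Y) Y (f \<circ> fst) snd \<le> homotopic_distance W B (g \<circ> q) r"
    proof (rule homotopic_distance_le)
      let ?XY = "prod_topology X Y" and ?k = "\<lambda>z. p (u (fst z), v (snd z))"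
      have "continuous_map ?XY (prod_topology A B) (\<lambda>z. ((u \<circ> fst) z, (v \<circ> snd) z))"
        using cu cv continuous_map_fst continuous_map_snd
        by (intro continuous_map_pairedI continuous_map_compose)
      from continuous_map_compose[OF this cp]
      show "continuous_map ?XY W ?k" by (simp add: o_def)
      show "continuous_map B Y v'" by (rule cv')
      have k: "q (?k z) = u (fst z) \<and> r (?k z) = v (snd z)" if "z \<in> topspace ?XY" for z
        using cu cv that by (intro qrp) (auto simp: continuous_map_def)
      have "homotopic_with (\<lambda>_. True) ?XY Y (f \<circ> fst) (v' \<circ> (g \<circ> u) \<circ> fst)"
        by (rule homotopic_with_compose_continuous_map_right[OF f_eq continuous_map_fst]) simp
      then show "homotopic_with (\<lambda>_. True) ?XY Y (f \<circ> fst) (v' \<circ> (g \<circ> q \<circ> ?k))"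
        unfolding homotopic_with_True using k by simp
      have "homotopic_with (\<lambda>_. True) ?XY Y (id \<circ> snd) (v' \<circ> v \<circ> snd)"
        by (rule homotopic_with_compose_continuous_map_right[OF homotopic_with_symD[OF v'v]
            continuous_map_snd]) simp
      then show "homotopic_with (\<lambda>_. True) ?XY Y snd (v' \<circ> (r \<circ> ?k))"
        unfolding homotopic_with_True using k by simp
    qed
  qed
qed

theorem proposition3p2:
  fixes G :: "('g, 'a) monoid_scheme" and K :: "('k, 'b) monoid_scheme"
    and \<phi> :: "'g \<Rightarrow> 'k \<Rightarrow> 'k" and d :: "'g \<Rightarrow> 'k"
    and X :: "'x topology" and Y :: "'y topology" and f :: "'x \<Rightarrow> 'y"
  assumes "group G" and "group K"
    and action: "\<phi> \<in> hom G (AutoGroup K)"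
    and trivial: "\<forall>g \<in> carrier G. \<forall>k \<in> carrier K. \<phi> g k = k"
    and "derivation G K \<phi> d"
    and Bd_model: "fibrational_replacement X Y f
           (classifying_space G) (classifying_space K) (classifying_map K d)"
  shows "tc G K \<phi> d = TC_map X Y f"
proof -
  have fib: "fibration X Y f" using Bd_model by (simp add: fibrational_replacement_def)
  then have f: "continuous_map X Y f" by (simp add: fibration_def)
  obtain u v where u: "homotopy_equivalence_map X (classifying_space G) u"
    and v: "homotopy_equivalence_map Y (classifying_space K) v"
    and vf: "homotopic_with (\<lambda>_. True) X (classifying_space K) (v \<circ> f) (classifying_map K d \<circ> u)"
    using Bd_model by (auto simp: fibrational_replacement_def)
  have "d \<in> hom G K"
    using \<open>derivation G K \<phi> d\<close> trivial by (auto simp: derivation_def hom_def Pi_iff)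
  then have Bd: "continuous_map (classifying_space G) (classifying_space K) (classifying_map K d)"
    using continuous_map_classifying_map[OF \<open>group G\<close> \<open>group K\<close>] by blast
  have "tc G K \<phi> d = homotopic_distance (classifying_space (semidirect_product K G \<phi>))
      (classifying_space K) (classifying_map K d \<circ> classifying_map G snd) (classifying_map K fst)"
    using tc_eq_homotopic_distance[OF assms(1-5)] .
  also have "\<dots> = homotopic_distance (prod_topology X Y) Y (f \<circ> fst) snd"
    using homotopic_distance_homotopy_equivalent[OF
        homeomorphic_map_classifying_space_product[OF assms(1-4)] f Bd u v vf] .
  also have "\<dots> = TC_map X Y f"
    using TC_map_eq_homotopic_distance[OF fib] by simp
  finally show ?thesis .
qed

end
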